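(* Consider the parameter regime $$\frac{\gamma^2}{d}\mathrm{Tr}(\mathbf B_R\boldsymbol\Sigma)\ll\sigma^2 .$$ In the low-temperature limit $T\to0$ followed by $k\to\infty$, the leading-order generalization error for $\mathbf w_R=\mathbf w_T=\mathbf w$ is given by $$\delta=\frac{\pi\sigma^2}{k^2}\,\frac{1}{\sqrt{1-\frac{2}{\sigma^2d}\,\mathbf u^\top\boldsymbol\Sigma\,\mathbf u}},\qquad \mathbf u:=\mathbf B_R\mathbf w .$$
   Context: Setting. Inputs $\mathbf x\in\mathbb R^d$ are drawn from $\mathcal N(0,\boldsymbol\Sigma)$ with $\mathrm{Tr}(\boldsymbol\Sigma)=\Theta(d)$. The teacher weight $\mathbf w_T\in\mathbb R^d$ has $\|\mathbf w_T\|^2=d$, and labels are $y=\frac{1}{\sqrt d}\mathbf w_T\cdot\mathbf x+\eta$ with $\eta\sim\mathcal N(0,\sigma^2)$. Bayesian linear regression with prior $\mathcal N(0,\gamma^2\mathbf I)$ on the weights is trained on $n$ i.i.d. samples. At inference, $k$ samples $y_1,\dots,y_k$ are drawn from the posterior predictive at $\mathbf x$, and one is selected with probability proportional to $e^{r(y_i,\mathbf x)/T}$, where $T$ is the temperature, $r(y,\mathbf x)=-(y-\frac{1}{\sqrt d}\mathbf w_R\cdot\mathbf x)^2$ is the reward, and $\mathbf w_R\in\mathbb R^d$ is the reward weight. In the limit $d,n\to\infty$ with $\alpha=d/n<1$ fixed, and for sufficiently small $\sigma$ (to leading order in $\sigma$), the posterior predictive at $\mathbf x$ is taken to be $\mathcal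 N(m(\mathbf x),s(\mathbf x)^2)$ with $$m(\mathbf x)=\tfrac{1}{\sqrt d}\mathbf x^\top\mathbf A_R\mathbf w_T,\qquad s(\mathbf x)^2=\sigma^2+\tfrac{\gamma^2}{d}\mathbf x^\top\mathbf B_R\mathbf x,$$ where $\mathbf A_R=\boldsymbol\Sigma(\boldsymbol\Sigma+R\mathbf I)^{-1}$, $\mathbf B_R=R(\boldsymbol\Sigma+R\mathbf I)^{-1}=\mathbf I-\mathbf A_R$, and $R$ solves $R\big(1-\alpha\,m_{\boldsymbol\Sigma}(R)\big)=\frac{\sigma^2}{\gamma^2}\alpha$ with $m_{\boldsymbol\Sigma}(R)=\frac1d\mathrm{Tr}[\boldsymbol\Sigma(\boldsymbol\Sigma+R\mathbf I)^{-1}]$. Put $\mu_T(\mathbf x)=\frac{1}{\sqrt d}\mathbf w_T\cdot\mathbf x$ and $\mu_R(\mathbf x)=\frac{1}{\sqrt d}\mathbf w_R\cdot\mathbf x$. The generalization error is $\delta=\mathbb E_{\mathbf x}[\delta(\mathbf x)]$ with $\mathbf x\sim\mathcal N(0,\boldsymbol\Sigma)$ and $$\delta(\mathbf x)=\mathbb E\left[\frac{\sum_{i=1}^k (y_i-\mu_T(\mathbf x))^2e^{-(y_i-\mu_R(\mathbf x))^2/T}}{\sum_{j=1}^k e^{-(y_j-\mu_R(\mathbf x))^2/T}}\right],\qquad y_i\ \text{i.i.d.}\sim\mathcal N(m(\mathbf x),s(\mathbf x)^2).$$ The claim refines the pointwise statement that, for $\mathbf w_R=\mathbf w_T$, the leading-order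 result for $T\to0$ followed by $k\to\infty$ is $\delta(\mathbf x)=\frac{\pi}{k^2}s(\mathbf x)^2\exp\big(\Delta_T(\mathbf x)^2/s(\mathbf x)^2\big)$, where $\Delta_T(\mathbf x)=m(\mathbf x)-\mu_T(\mathbf x)$; in the stated regime $s(\mathbf x)^2$ is approximated by $\sigma^2$ before averaging over $\mathbf x$.
   Formalization: The formal theorem adds that (2/(σ²d)) uᵀΣu stays below a constant c < 1 along the parameter family; when it exceeds 1 the square root is undefined, and when it tends to 1 too fast the leading-order formula fails. *)

theory Defs
  imports
    "HOL-Probability.Probability"
    "HOL-Library.Landau_Symbols"
    "Jordan_Normal_Form.Gauss_Jordan_Elimination"
begin

text \<open>Vectors and matrices are those of Jordan-Normal-Form, so that the dimension \<open>d\<close> is an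
  ordinary natural number that may vary with the problem instance.\<close>

definition mat_trace :: "real mat \<Rightarrow> real" where
  "mat_trace A = (\<Sum>i<dim_row A. A $$ (i, i))"

definition cov_mat :: "nat \<Rightarrow> real mat \<Rightarrow> bool" where
  "cov_mat d S \<longleftrightarrow> S \<in> carrier_mat d d \<and> transpose_mat S = S \<and>
     (\<forall>v\<in>carrier_vec d. 0 \<le> v \<bullet> (S *\<^sub>v v))"

text \<open>A centred Gaussian vector with covariance \<open>S\<close>, by its characteristic function; a singular
  \<open>S\<close> is allowed.\<close>

definition gaussian_vec :: "'a measure \<Rightarrow> nat \<Rightarrow> real mat \<Rightarrow> ('a \<Rightarrow> real vec) \<Rightarrow> bool" where
  "gaussian_vec M d S X \<longleftrightarrow> prob_space M \<and> (\<forall>\<omega>\<in>space M. X \<omega> \<in> carrier_vec d) \<and>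
     (\<forall>a\<in>carrier_vec d. (\<lambda>\<omega>. a \<bullet> X \<omega>) \<in> borel_measurable M \<and>
        (CLINT \<omega>|M. iexp (a \<bullet> X \<omega>)) = exp (- complex_of_real (a \<bullet> (S *\<^sub>v a)) / 2))"

text \<open>For \<open>R > 0\<close> and positive semidefinite \<open>S\<close> the matrix \<open>S + R I\<close> is invertible, so \<open>the\<close>
  below returns its inverse.\<close>

definition resolvent :: "nat \<Rightarrow> real mat \<Rightarrow> real \<Rightarrow> real mat" where
  "resolvent d S R = the (mat_inverse (S + R \<cdot>\<^sub>m 1\<^sub>m d))"

definition A_mat :: "nat \<Rightarrow> real mat \<Rightarrow> real \<Rightarrow> real mat" where
  "A_mat d S R = S * resolvent d S R"

definition B_mat :: "nat \<Rightarrow> real mat \<Rightarrow> real \<Rightarrow> real mat" where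
  "B_mat d S R = R \<cdot>\<^sub>m resolvent d S R"

definition m_fun :: "nat \<Rightarrow> real mat \<Rightarrow> real \<Rightarrow> real" where
  "m_fun d S R = mat_trace (A_mat d S R) / real d"

definition lin_mean :: "nat \<Rightarrow> real vec \<Rightarrow> real vec \<Rightarrow> real" where
  "lin_mean d w x = (w \<bullet> x) / sqrt (real d)"

definition pred_mean :: "nat \<Rightarrow> real mat \<Rightarrow> real \<Rightarrow> real vec \<Rightarrow> real vec \<Rightarrow> real" where
  "pred_mean d S R wT x = (x \<bullet> (A_mat d S R *\<^sub>v wT)) / sqrt (real d)"

definition pred_var :: "nat \<Rightarrow> real mat \<Rightarrow> real \<Rightarrow> real \<Rightarrow> real \<Rightarrow> real vec \<Rightarrow> real" where
  "pred_var d S R \<sigma> \<gamma> x = \<sigma>\<^sup>2 + \<gamma>\<^sup>2 / real d * (x \<bullet> (B_mat d S R *\<^sub>v x))"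

definition reward :: "nat \<Rightarrow> real vec \<Rightarrow> real \<Rightarrow> real vec \<Rightarrow> real" where
  "reward d wR y x = - (y - lin_mean d wR x)\<^sup>2"

text \<open>The error at \<open>x\<close> of the sample selected, with probability proportional to
  \<open>exp (reward / T)\<close>, among \<open>k\<close> independent draws from the posterior predictive.\<close>

definition gen_err_at ::
  "nat \<Rightarrow> real mat \<Rightarrow> real \<Rightarrow> real \<Rightarrow> real \<Rightarrow> real vec \<Rightarrow> real vec \<Rightarrow> nat \<Rightarrow> real \<Rightarrow> real vec \<Rightarrow> real"
where
  "gen_err_at d S R \<sigma> \<gamma> wT wR k T x =
     (\<integral>y. (\<Sum>i<k. (y i - lin_mean d wT x)\<^sup>2 * exp (reward d wR (y i) x / T)) /
           (\<Sum>j<k. exp (reward d wR (y j) x / T))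
      \<partial>(\<Pi>\<^sub>M i\<in>{..<k}. density lborel
           (normal_density (pred_mean d S R wT x) (sqrt (pred_var d S R \<sigma> \<gamma> x)))))"

definition gen_err ::
  "'a measure \<Rightarrow> ('a \<Rightarrow> real vec) \<Rightarrow> nat \<Rightarrow> real mat \<Rightarrow> real \<Rightarrow> real \<Rightarrow> real \<Rightarrow>
     real vec \<Rightarrow> real vec \<Rightarrow> nat \<Rightarrow> real \<Rightarrow> real"
where
  "gen_err M X d S R \<sigma> \<gamma> wT wR k T =
     (\<integral>\<omega>. gen_err_at d S R \<sigma> \<gamma> wT wR k T (X \<omega>) \<partial>M)"

end

theory Submission
  imports
    Defs
    "Jordan_Normal_Form.Determinant"
    "HOL-Real_Asymp.Real_Asymp"
begin

text \<open>
  Since \<open>A + B = I\<close>, the bias of the predictive mean is \<open>\<Delta>(x) = - (u \<bullet> x) / sqrt d\<close>, a centred Gaussian.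
  As \<open>T\<close> tends to 0, the soft selection converges uniformly to the smallest of the \<open>k\<close> squared
  errors, with error at most \<open>k T\<close>. For \<open>Z\<close> standard normal and \<open>a = \<Delta> / s\<close>, \<open>k\<^sup>2\<close> times the mean
  of that minimum is \<open>s\<^sup>2\<close> times the integral of \<open>2 r P(\<bar>a + Z\<bar> \<ge> r / k) ^ k\<close> over \<open>r \<ge> 0\<close>, which
  tends to \<open>s\<^sup>2 \<pi> exp (a\<^sup>2)\<close>. The bound \<open>P(\<bar>a + Z\<bar> \<ge> r) \<le> (1 + \<eta> r) ^ (-4)\<close> survives the \<open>k\<close>-th power
  by Bernoulli's inequality and dominates, uniformly in \<open>k\<close>, by a multiple of
  \<open>(s\<^sup>2 + \<Delta>\<^sup>2) exp (\<Delta>\<^sup>2 / s\<^sup>2)\<close>.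

  Write \<open>s\<^sup>2 = \<sigma>\<^sup>2 (1 + t)\<close> and \<open>g = \<Delta>\<^sup>2 / \<sigma>\<^sup>2\<close>. Replacing \<open>(1 + t) exp (g / (1 + t))\<close> by \<open>exp g\<close> costs at
  most \<open>t (1 + g) exp g\<close>, whose mean is at most a constant times the mean of \<open>t\<close>, that is,
  times \<open>\<gamma>\<^sup>2 Tr (B \<Sigma>) / (d \<sigma>\<^sup>2)\<close>; and \<open>exp g\<close> has mean \<open>1 / sqrt (1 - 2 u \<bullet> \<Sigma> u / (\<sigma>\<^sup>2 d))\<close>.
\<close>

no_notation inner (infix "\<bullet>" 70)
no_notation vec_nth (infixl "$" 90)
no_notation fps_nth (infixl "$" 75)

section \<open>The ridge matrices\<close>

text \<open>Cholesky elimination: the last row and column are split off as a rank-one term, and the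
  Schur complement is again positive semidefinite. The decomposition serves to write the quadratic
  form in the predictive variance as a sum of squares of linear forms, each a scalar
  Gaussian.\<close>

lemma psd_sum_of_squares:
  fixes B :: "nat \<Rightarrow> nat \<Rightarrow> real"
  assumes "\<And>i j. i < n \<Longrightarrow> j < n \<Longrightarrow> B i j = B j i"
    and "\<And>x. 0 \<le> (\<Sum>i<n. \<Sum>j<n. x i * B i j * x j)"
  shows "\<exists>a::nat \<Rightarrow> nat \<Rightarrow> real. \<forall>i<n. \<forall>j<n. B i j = (\<Sum>l<n. a l i * a l j)"
  using assms
proof (induction n arbitrary: B)
  case 0
  then show ?case by simp
next
  case (Suc n)
  define p where "p = B n n"
  have expand: "(\<Sum>i<Suc n. \<Sum>j<Suc n. x i * B i j * x j) =
      (\<Sum>i<n. \<Sum>j<n. x i * B i j * x j) + 2 * x n * (\<Sum>i<n. x i * B i n) + p * (x n)\<^sup>2" for x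
  proof -
    have "(\<Sum>j<n. x n * B n j * x j) = x n * (\<Sum>i<n. x i * B i n)"
      unfolding sum_distrib_left by (rule sum.cong) (use Suc.prems(1) in auto)
    moreover have "(\<Sum>i<n. x i * B i n * x n) = x n * (\<Sum>i<n. x i * B i n)"
      unfolding sum_distrib_left by (rule sum.cong) auto
    ultimately show ?thesis
      by (simp add: sum.distrib p_def power2_eq_square algebra_simps)
  qed
  have p0: "0 \<le> p"
    using Suc.prems(2)[of "\<lambda>i. if i = n then 1 else 0"] by (simp add: expand del: sum.lessThan_Suc)
  \<comment> \<open>A zero pivot forces its whole column to vanish, since otherwise the form would
    take a negative value. The \<open>t\<close> below makes the form equal -1 at the vector with
    entry 1 at \<open>i\<close>, entry \<open>t\<close> at \<open>n\<close> and zeros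
    elsewhere.\<close>
  have col0: "B i n = 0" if "p = 0" "i < n" for i
  proof (rule ccontr)
    assume b: "B i n \<noteq> 0"
    define t where "t = - (B i i + 1) / (2 * B i n)"
    define x where "x = (\<lambda>j. if j = i then 1 else if j = n then t else 0)"
    have "(\<Sum>j<n. x j * B j n) = (\<Sum>j<n. if j = i then B i n else 0)"
      by (rule sum.cong) (auto simp: x_def)
    then have s1: "(\<Sum>j<n. x j * B j n) = B i n" using that by simp
    have "(\<Sum>j<n. x k * B k j * x j) = (if k = i then B i i else 0)" if "k < n" for k
    proof -
      have "(\<Sum>j<n. x k * B k j * x j) = (\<Sum>j<n. if j = i then x k * B k i else 0)"
        by (rule sum.cong) (auto simp: x_def)
      then show ?thesis using that \<open>i < n\<close> by (auto simp: x_def)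
    qed
    then have s2: "(\<Sum>k<n. \<Sum>j<n. x k * B k j * x j) = B i i"
      using \<open>i < n\<close> by simp
    have "0 \<le> B i i + 2 * x n * B i n"
      using Suc.prems(2)[of x] \<open>p = 0\<close> unfolding expand s1 s2 by simp
    also have "x n = t" using \<open>i < n\<close> by (simp add: x_def)
    also have "B i i + 2 * t * B i n = -1" using b by (simp add: t_def field_simps)
    finally show False by simp
  qed
  \<comment> \<open>The Schur complement. For \<open>p = 0\<close> the convention
    \<open>x / 0 = 0\<close> turns it into \<open>B\<close> itself, so both cases share one
    definition.\<close>
  define B' where "B' = (\<lambda>i j. B i j - B i n * B j n / p)"
  have "\<exists>a::nat \<Rightarrow> nat \<Rightarrow> real. \<forall>i<n. \<forall>j<n. B' i j = (\<Sum>l<n. a l i * a l j)"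
  proof (rule Suc.IH)
    show "B' i j = B' j i" if "i < n" "j < n" for i j
      using Suc.prems(1)[of i j] that by (simp add: B'_def)
    fix x :: "nat \<Rightarrow> real"
    define s where "s = (\<Sum>i<n. x i * B i n)"
    \<comment> \<open>Completing the square: for \<open>p > 0\<close>, the last coordinate
      \<open>- s / p\<close> minimises the form with the others held fixed, and the minimum is the
      form of \<open>B'\<close> at \<open>x\<close>.\<close>
    define y where "y = x(n := - s / p)"
    have sy: "(\<Sum>i<n. y i * B i n) = s"
      unfolding s_def y_def by (rule sum.cong) auto
    have qy: "(\<Sum>i<n. \<Sum>j<n. y i * B i j * y j) = (\<Sum>i<n. \<Sum>j<n. x i * B i j * x j)"
      by (intro sum.cong refl) (auto simp: y_def)
    have "s\<^sup>2 = (\<Sum>i<n. \<Sum>j<n. x i * B i n * (x j * B j n))"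
      by (simp add: s_def power2_eq_square sum_product)
    then have "(\<Sum>i<n. \<Sum>j<n. x i * B' i j * x j) = (\<Sum>i<n. \<Sum>j<n. x i * B i j * x j) - s\<^sup>2 / p"
      by (simp add: B'_def algebra_simps sum_subtractf sum_divide_distrib)
    also have "\<dots> = (\<Sum>i<Suc n. \<Sum>j<Suc n. y i * B i j * y j)"
      unfolding expand sy qy using p0 by (cases "p = 0") (auto simp: y_def power2_eq_square field_simps)
    finally show "0 \<le> (\<Sum>i<n. \<Sum>j<n. x i * B' i j * x j)"
      using Suc.prems(2)[of y] by simp
  qed
  then obtain a where a: "\<And>i j. i < n \<Longrightarrow> j < n \<Longrightarrow> B' i j = (\<Sum>l<n. a l i * a l j)" by blast
  \<comment> \<open>The new square carries the pivot column divided by \<open>sqrt p\<close>; the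
    old ones ignore coordinate \<open>n\<close>. If \<open>p = 0\<close>, the new square is zero,
    which is correct by \<open>col0\<close>.\<close>
  define a' where "a' = (\<lambda>l i. if l = n then B i n / sqrt p else if i = n then 0 else a l i)"
  have "B i j = (\<Sum>l<Suc n. a' l i * a' l j)" if ij: "i < Suc n" "j < Suc n" for i j
  proof -
    have "a' n i * a' n j = B i n * B j n / p"
      using p0 by (simp add: a'_def)
    moreover have "(\<Sum>l<n. a' l i * a' l j) = B i j - B i n * B j n / p"
    proof (cases "i = n \<or> j = n")
      case True
      have "(\<Sum>l<n. a' l i * a' l j) = 0"
        using True by (intro sum.neutral) (auto simp: a'_def)
      moreover have "B i j = B i n * B j n / p"
        using True col0[of i] col0[of j] Suc.prems(1)[of i j] ij
        by (cases "p = 0") (auto simp: p_def less_Suc_eq)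
      ultimately show ?thesis by simp
    next
      case False
      then have "i < n" "j < n" using ij by auto
      with a[of i j] show ?thesis by (simp add: a'_def B'_def)
    qed
    ultimately show ?thesis by simp
  qed
  then show ?case by blast
qed

section \<open>Invertibility and symmetry of the resolvent\<close>

lemma transpose_smult_mat: "transpose_mat (k \<cdot>\<^sub>m A) = k \<cdot>\<^sub>m transpose_mat A"
  by (rule eq_matI) auto

lemma smult_mat_mult_vec:
  fixes A :: "'a :: comm_semiring_0 mat"
  assumes "A \<in> carrier_mat nr nc" "v \<in> carrier_vec nc"
  shows "(k \<cdot>\<^sub>m A) *\<^sub>v v = k \<cdot>\<^sub>v (A *\<^sub>v v)"
  using assms by (intro eq_vecI) auto

text \<open>The form of \<open>S + R I\<close> at \<open>v\<close> is at least
  \<open>R * (v . v)\<close>, so the kernel is trivial and the determinant nonzero. This justifies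
  the use of \<open>the\<close> in \<open>resolvent\<close>.\<close>

lemma resolvent_inverse:
  assumes "cov_mat d S" "0 < R"
  shows "resolvent d S R \<in> carrier_mat d d"
    and "(S + R \<cdot>\<^sub>m 1\<^sub>m d) * resolvent d S R = 1\<^sub>m d"
proof -
  let ?A = "S + R \<cdot>\<^sub>m 1\<^sub>m d"
  have S: "S \<in> carrier_mat d d" and psd: "\<And>v. v \<in> carrier_vec d \<Longrightarrow> 0 \<le> v \<bullet> (S *\<^sub>v v)"
    using assms by (auto simp: cov_mat_def)
  have A: "?A \<in> carrier_mat d d" using S by simp
  have "v = 0\<^sub>v d" if v: "v \<in> carrier_vec d" "?A *\<^sub>v v = 0\<^sub>v d" for v
  proof -
    have "?A *\<^sub>v v = S *\<^sub>v v + R \<cdot>\<^sub>v v"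
      using S v(1) by (simp add: add_mult_distrib_mat_vec[of _ d d] smult_mat_mult_vec[of _ d d])
    then have "0 = v \<bullet> (S *\<^sub>v v + R \<cdot>\<^sub>v v)" using v by (metis scalar_prod_right_zero)
    also have "\<dots> = v \<bullet> (S *\<^sub>v v) + R * (v \<bullet> v)"
      using S v(1) by (simp add: scalar_prod_add_distrib[of _ d])
    finally have "R * (v \<bullet> v) \<le> 0" using psd[OF v(1)] by linarith
    moreover have "0 \<le> v \<bullet> v" by (simp add: scalar_prod_def sum_nonneg)
    ultimately have "v \<bullet> v = 0" using \<open>0 < R\<close> by (simp add: mult_le_0_iff)
    then have "\<forall>i\<in>{0..<dim_vec v}. v $ i * v $ i = 0"
      unfolding scalar_prod_def by (subst (asm) sum_nonneg_eq_0_iff) auto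
    then show ?thesis using v(1) by (intro eq_vecI) auto
  qed
  then have "Determinant.det ?A \<noteq> 0"
    using det_0_iff_vec_prod_zero_field[OF A] by auto
  then have "?A \<in> Units (ring_mat TYPE(real) d ())"
    by (rule det_non_zero_imp_unit[OF A])
  then obtain C where C: "mat_inverse ?A = Some C"
    using mat_inverse(1)[OF A] by fastforce
  from mat_inverse(2)[OF A C] show "resolvent d S R \<in> carrier_mat d d" "?A * resolvent d S R = 1\<^sub>m d"
    by (simp_all add: resolvent_def C)
qed

text \<open>Transposing a right inverse of a symmetric matrix gives a left inverse, and the two must
  agree.\<close>

lemma resolvent_symmetric:
  assumes "cov_mat d S" "0 < R"
  shows "transpose_mat (resolvent d S R) = resolvent d S R"
proof -
  let ?A = "S + R \<cdot>\<^sub>m 1\<^sub>m d" and ?C = "resolvent d S R"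
  note C = resolvent_inverse[OF assms]
  have A: "?A \<in> carrier_mat d d" and tA: "transpose_mat ?A = ?A"
    using assms by (auto simp: cov_mat_def transpose_add[of _ d d] transpose_smult_mat)
  have "transpose_mat (?A * ?C) = transpose_mat ?C * ?A"
    using transpose_mult[OF A C(1)] tA by simp
  then have "transpose_mat ?C * ?A = 1\<^sub>m d" using C(2) by simp
  then have "transpose_mat ?C * (?A * ?C) = ?C"
    using A C(1) by (simp add: assoc_mult_mat[symmetric, of _ d d _ d _ d])
  then show ?thesis using C by simp
qed

lemma B_mat_carrier:
  assumes "cov_mat d S" "0 < R"
  shows "B_mat d S R \<in> carrier_mat d d"
  using resolvent_inverse(1)[OF assms] by (simp add: B_mat_def)

lemma A_mat_plus_B_mat:
  assumes "cov_mat d S" "0 < R"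
  shows "A_mat d S R + B_mat d S R = 1\<^sub>m d"
proof -
  let ?C = "resolvent d S R"
  have S: "S \<in> carrier_mat d d" using assms by (simp add: cov_mat_def)
  note C = resolvent_inverse[OF assms]
  have "1\<^sub>m d = (S + R \<cdot>\<^sub>m 1\<^sub>m d) * ?C" using C(2) by (rule sym)
  also have "\<dots> = S * ?C + (R \<cdot>\<^sub>m 1\<^sub>m d) * ?C"
    using S C(1) by (intro add_mult_distrib_mat) auto
  also have "(R \<cdot>\<^sub>m 1\<^sub>m d) * ?C = R \<cdot>\<^sub>m ?C"
    using C(1) by (simp add: mult_smult_assoc_mat[of _ d d])
  finally show ?thesis by (simp add: A_mat_def B_mat_def)
qed

text \<open>From \<open>A + B = I\<close> one gets \<open>A w - w = - B w\<close>. Hence the bias is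
  a linear form in \<open>x\<close>, with the vector \<open>u = B w\<close> of the theorem as its
  coefficients.\<close>

lemma pred_mean_minus_lin_mean:
  assumes "cov_mat d S" "0 < R" and w: "w \<in> carrier_vec d" and x: "x \<in> carrier_vec d"
  shows "pred_mean d S R w x - lin_mean d w x = - ((B_mat d S R *\<^sub>v w) \<bullet> x) / sqrt (real d)"
proof -
  let ?A = "A_mat d S R" and ?B = "B_mat d S R"
  have A: "?A \<in> carrier_mat d d"
    using resolvent_inverse(1)[OF assms(1,2)] assms(1) by (auto simp: A_mat_def cov_mat_def)
  note B = B_mat_carrier[OF assms(1,2)]
  have "w = (?A + ?B) *\<^sub>v w" unfolding A_mat_plus_B_mat[OF assms(1,2)] using w by simp
  also have "\<dots> = ?A *\<^sub>v w + ?B *\<^sub>v w" by (rule add_mult_distrib_mat_vec[OF A B w])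
  finally have "w \<bullet> x = (?A *\<^sub>v w + ?B *\<^sub>v w) \<bullet> x" by (rule arg_cong)
  then have "w \<bullet> x = (?A *\<^sub>v w) \<bullet> x + (?B *\<^sub>v w) \<bullet> x"
    using add_scalar_prod_distrib[OF mult_mat_vec_carrier[OF A w] mult_mat_vec_carrier[OF B w] x] by simp
  moreover have "x \<bullet> (?A *\<^sub>v w) = (?A *\<^sub>v w) \<bullet> x"
    using A w x by (simp add: comm_scalar_prod[of _ d])
  ultimately show ?thesis
    unfolding pred_mean_def lin_mean_def by (simp only: diff_divide_distrib[symmetric]) simp
qed

section \<open>The matrix \<open>B\<close> as a sum of squares\<close>

lemma scalar_prod_mult_mat_vec:
  fixes B :: "real mat"
  assumes "B \<in> carrier_mat d d" "x \<in> carrier_vec d" "y \<in> carrier_vec d"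
  shows "x \<bullet> (B *\<^sub>v y) = (\<Sum>i<d. \<Sum>j<d. x $ i * B $$ (i, j) * y $ j)"
proof -
  have "x \<bullet> (B *\<^sub>v y) = (\<Sum>i<d. x $ i * (\<Sum>j<d. B $$ (i, j) * y $ j))"
    using assms by (simp add: scalar_prod_def atLeast0LessThan)
  then show ?thesis by (simp add: sum_distrib_left mult.assoc)
qed

text \<open>With \<open>y\<close> the resolvent applied to \<open>x\<close>, one has
  \<open>x = S y + R y\<close>, so \<open>x . y\<close> is the form of \<open>S\<close> at
  \<open>y\<close> plus \<open>R * (y . y)\<close>. No spectral decomposition is involved.\<close>

lemma B_mat_psd:
  assumes "cov_mat d S" "0 < R" and x: "x \<in> carrier_vec d"
  shows "0 \<le> x \<bullet> (B_mat d S R *\<^sub>v x)"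
proof -
  let ?A = "S + R \<cdot>\<^sub>m 1\<^sub>m d" and ?C = "resolvent d S R"
  have S: "S \<in> carrier_mat d d" and psd: "\<And>v. v \<in> carrier_vec d \<Longrightarrow> 0 \<le> v \<bullet> (S *\<^sub>v v)"
    using assms by (auto simp: cov_mat_def)
  note C = resolvent_inverse[OF assms(1,2)]
  define y where "y = ?C *\<^sub>v x"
  have y: "y \<in> carrier_vec d" using C x by (simp add: y_def)
  have A: "?A \<in> carrier_mat d d" using S by simp
  have "x = (?A * ?C) *\<^sub>v x" using C x by simp
  also have "\<dots> = ?A *\<^sub>v y" unfolding y_def by (rule assoc_mult_mat_vec[OF A C(1) x])
  also have "\<dots> = S *\<^sub>v y + R \<cdot>\<^sub>v y" using S y by (simp add: add_mult_distrib_mat_vec[of _ d d] smult_mat_mult_vec[of _ d d])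
  finally have "x \<bullet> y = (S *\<^sub>v y + R \<cdot>\<^sub>v y) \<bullet> y" by (rule arg_cong)
  also have "\<dots> = (S *\<^sub>v y) \<bullet> y + R * (y \<bullet> y)"
    using S y by (simp add: add_scalar_prod_distrib[of _ d])
  also have "(S *\<^sub>v y) \<bullet> y = y \<bullet> (S *\<^sub>v y)" using S y by (simp add: comm_scalar_prod[of _ d])
  finally have "0 \<le> x \<bullet> y"
    using psd[OF y] \<open>0 < R\<close> by (simp add: scalar_prod_def sum_nonneg)
  moreover have "B_mat d S R *\<^sub>v x = R \<cdot>\<^sub>v y"
    using C x by (simp add: B_mat_def y_def smult_mat_mult_vec[of _ d d])
  ultimately show ?thesis using \<open>0 < R\<close> x y by simp
qed

text \<open>The same vectors \<open>a l\<close> must serve both identities: for a Gaussian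
  \<open>x\<close> with covariance \<open>S\<close>, the summands of the trace are the variances of
  the forms \<open>a l . x\<close> whose squares make up the quadratic form. This links the trace in
  the regime to the predictive variance.\<close>

lemma B_mat_sum_of_squares:
  assumes "cov_mat d S" "0 < R"
  obtains a where "\<And>l. a l \<in> carrier_vec d"
    and "\<And>x. x \<in> carrier_vec d \<Longrightarrow> x \<bullet> (B_mat d S R *\<^sub>v x) = (\<Sum>l<d. (a l \<bullet> x)\<^sup>2)"
    and "mat_trace (B_mat d S R * S) = (\<Sum>l<d. a l \<bullet> (S *\<^sub>v a l))"
proof -
  let ?B = "B_mat d S R"
  have S: "S \<in> carrier_mat d d" and tS: "transpose_mat S = S"
    using assms by (auto simp: cov_mat_def)
  note B = B_mat_carrier[OF assms]
  have tB: "transpose_mat ?B = ?B"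
    using resolvent_symmetric[OF assms] by (simp add: B_mat_def transpose_smult_mat)
  have symS: "S $$ (i, j) = S $$ (j, i)" if "i < d" "j < d" for i j
    using that S by (subst tS[symmetric]) simp
  have symB: "?B $$ (i, j) = ?B $$ (j, i)" if "i < d" "j < d" for i j
    using that B by (subst tB[symmetric]) simp
  have "0 \<le> (\<Sum>i<d. \<Sum>j<d. x i * ?B $$ (i, j) * x j)" for x
    using B_mat_psd[OF assms, of "vec d x"] by (simp add: scalar_prod_mult_mat_vec[OF B])
  from psd_sum_of_squares[of d "\<lambda>i j. ?B $$ (i, j)", OF symB this]
  obtain b where b: "\<And>i j. i < d \<Longrightarrow> j < d \<Longrightarrow> ?B $$ (i, j) = (\<Sum>l<d. b l i * b l j)"
    by blast
  define a where "a l = vec d (b l)" for l :: nat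
  have sq: "(a l \<bullet> x)\<^sup>2 = (\<Sum>i<d. \<Sum>j<d. x $ i * (b l i * b l j) * x $ j)"
    if "x \<in> carrier_vec d" for l x
    using that by (simp add: a_def scalar_prod_def power2_eq_square sum_product atLeast0LessThan mult_ac)
  have quad: "x \<bullet> (?B *\<^sub>v x) = (\<Sum>l<d. (a l \<bullet> x)\<^sup>2)" if x: "x \<in> carrier_vec d" for x
  proof -
    have "x \<bullet> (?B *\<^sub>v x) = (\<Sum>i<d. \<Sum>j<d. \<Sum>l<d. x $ i * (b l i * b l j) * x $ j)"
      unfolding scalar_prod_mult_mat_vec[OF B x x]
      by (intro sum.cong refl) (simp add: b sum_distrib_left sum_distrib_right)
    also have "\<dots> = (\<Sum>i<d. \<Sum>l<d. \<Sum>j<d. x $ i * (b l i * b l j) * x $ j)"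
      by (intro sum.cong refl sum.swap)
    also have "\<dots> = (\<Sum>l<d. \<Sum>i<d. \<Sum>j<d. x $ i * (b l i * b l j) * x $ j)"
      using sum.swap[of "\<lambda>i l. \<Sum>j<d. x $ i * (b l i * b l j) * x $ j" "{..<d}" "{..<d}"]
      by (simp only:)
    finally show ?thesis by (simp add: sq[OF x])
  qed
  have "mat_trace (?B * S) = (\<Sum>i<d. \<Sum>j<d. ?B $$ (i, j) * S $$ (j, i))"
    using B S by (simp add: mat_trace_def scalar_prod_def atLeast0LessThan)
  also have "\<dots> = (\<Sum>i<d. \<Sum>j<d. \<Sum>l<d. b l i * S $$ (i, j) * b l j)"
    by (intro sum.cong refl) (simp add: b sum_distrib_left sum_distrib_right symS mult_ac)
  also have "\<dots> = (\<Sum>i<d. \<Sum>l<d. \<Sum>j<d. b l i * S $$ (i, j) * b l j)"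
    by (intro sum.cong refl sum.swap)
  also have "\<dots> = (\<Sum>l<d. \<Sum>i<d. \<Sum>j<d. b l i * S $$ (i, j) * b l j)"
    by (rule sum.swap)
  also have "\<dots> = (\<Sum>l<d. a l \<bullet> (S *\<^sub>v a l))"
    by (simp add: a_def scalar_prod_mult_mat_vec[OF S])
  finally have tr: "mat_trace (?B * S) = (\<Sum>l<d. a l \<bullet> (S *\<^sub>v a l))" .
  show thesis by (rule that[OF _ quad tr]) (simp_all add: a_def)
qed

section \<open>Centred Gaussian variables\<close>

text \<open>The weighted density is \<open>r\<close> times the normal density of standard deviation
  \<open>r = 1 / sqrt (1 - 2 * l)\<close>, so its integral is \<open>r\<close>.\<close>

lemma std_normal_exp_square:
  assumes "l < 1 / 2"
  shows "integrable std_normal_distribution (\<lambda>z. exp (l * z\<^sup>2))"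
    and "(\<integral>z. exp (l * z\<^sup>2) \<partial>std_normal_distribution) = 1 / sqrt (1 - 2 * l)"
proof -
  define r where "r = 1 / sqrt (1 - 2 * l)"
  have r: "0 < r" "r\<^sup>2 = 1 / (1 - 2 * l)" using assms by (auto simp: r_def power_divide)
  have eq: "std_normal_density z * exp (l * z\<^sup>2) = r * normal_density 0 r z" for z
  proof -
    have "z\<^sup>2 / (2 * r\<^sup>2) = z\<^sup>2 / 2 - l * z\<^sup>2"
      using assms by (simp add: r field_simps)
    then have "exp (- z\<^sup>2 / 2) * exp (l * z\<^sup>2) = exp (- z\<^sup>2 / (2 * r\<^sup>2))"
      by (simp add: exp_add[symmetric])
    moreover have "sqrt (2 * pi * r\<^sup>2) = sqrt (2 * pi) * r"
      using r(1) by (simp add: real_sqrt_mult real_sqrt_abs)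
    ultimately show ?thesis
      using r(1) by (simp add: normal_density_def)
  qed
  show "integrable std_normal_distribution (\<lambda>z. exp (l * z\<^sup>2))"
    using r by (subst integrable_density) (simp_all add: eq)
  show "(\<integral>z. exp (l * z\<^sup>2) \<partial>std_normal_distribution) = 1 / sqrt (1 - 2 * l)"
    using r by (subst integral_density) (simp_all add: eq, simp add: r_def)
qed

text \<open>Stated through the image law of a standard normal rather than a density, so that
  \<open>s = 0\<close> is included; this occurs for directions in the kernel of a singular
  covariance.\<close>

definition centred_normal :: "'a measure \<Rightarrow> real \<Rightarrow> ('a \<Rightarrow> real) \<Rightarrow> bool" where
  "centred_normal M s f \<longleftrightarrow> f \<in> borel_measurable M \<and>
     distr M borel f = distr std_normal_distribution borel (\<lambda>z. s * z)"

lemma centred_normal_integral: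
  fixes h :: "real \<Rightarrow> real"
  assumes "centred_normal M s f" and [measurable]: "h \<in> borel_measurable borel"
  shows "integrable M (\<lambda>\<omega>. h (f \<omega>)) \<longleftrightarrow> integrable std_normal_distribution (\<lambda>z. h (s * z))"
    and "(\<integral>\<omega>. h (f \<omega>) \<partial>M) = (\<integral>z. h (s * z) \<partial>std_normal_distribution)"
proof -
  have [measurable]: "f \<in> borel_measurable M"
    and eq: "distr M borel f = distr std_normal_distribution borel (\<lambda>z. s * z)"
    using assms(1) by (auto simp: centred_normal_def)
  have "integrable M (\<lambda>\<omega>. h (f \<omega>)) \<longleftrightarrow> integrable (distr M borel f) h"
    by (subst integrable_distr_eq) auto
  also have "\<dots> \<longleftrightarrow> integrable std_normal_distribution (\<lambda>z. h (s * z))"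
    unfolding eq by (subst integrable_distr_eq) auto
  finally show "integrable M (\<lambda>\<omega>. h (f \<omega>)) \<longleftrightarrow> integrable std_normal_distribution (\<lambda>z. h (s * z))" .
  have "(\<integral>\<omega>. h (f \<omega>) \<partial>M) = integral\<^sup>L (distr M borel f) h"
    by (subst integral_distr) auto
  also have "\<dots> = (\<integral>z. h (s * z) \<partial>std_normal_distribution)"
    unfolding eq by (subst integral_distr) auto
  finally show "(\<integral>\<omega>. h (f \<omega>) \<partial>M) = (\<integral>z. h (s * z) \<partial>std_normal_distribution)" .
qed

lemma centred_normal_exp_square:
  assumes f: "centred_normal M s f" and l: "l * s\<^sup>2 < 1 / 2"
  shows "integrable M (\<lambda>\<omega>. exp (l * (f \<omega>)\<^sup>2))"
    and "(\<integral>\<omega>. exp (l * (f \<omega>)\<^sup>2) \<partial>M) = 1 / sqrt (1 - 2 * l * s\<^sup>2)"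
  using centred_normal_integral[OF f, of "\<lambda>x. exp (l * x\<^sup>2)"] std_normal_exp_square[OF l]
  by (simp_all add: power_mult_distrib mult.assoc)

text \<open>First \<open>y\<close> is bounded by \<open>4 q exp (y / (4 q))\<close>. The exponent
  \<open>y / (4 q) + h\<close> is then a convex combination of \<open>y / 4\<close> and
  \<open>p h\<close> with weights \<open>1 / q\<close> and \<open>1 / p\<close>, hence at most their
  maximum.\<close>

lemma mult_exp_le_exp_add_exp:
  fixes y h p q :: real
  assumes "0 < p" "0 < q" "1 / p + 1 / q = 1"
  shows "y * exp h \<le> 4 * q * (exp (y / 4) + exp (p * h))"
proof -
  have "y / (4 * q) \<le> exp (y / (4 * q))"
    using exp_ge_add_one_self[of "y / (4 * q)"] by linarith
  then have "y / (4 * q) * exp h \<le> exp (y / (4 * q) + h)"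
    unfolding exp_add by (rule mult_right_mono) simp
  also have "y / (4 * q) + h \<le> max (y / 4) (p * h)"
  proof -
    have "y / (4 * q) + h = (1 / q) * (y / 4) + (1 / p) * (p * h)"
      using assms by simp
    also have "\<dots> \<le> (1 / q) * max (y / 4) (p * h) + (1 / p) * max (y / 4) (p * h)"
      using assms by (intro add_mono mult_left_mono) auto
    also have "\<dots> = (1 / p + 1 / q) * max (y / 4) (p * h)" by (simp add: algebra_simps)
    finally show ?thesis using assms by simp
  qed
  also have "exp (max (y / 4) (p * h)) \<le> exp (y / 4) + exp (p * h)"
    by (simp add: max_def)
  finally show ?thesis using assms by (simp add: field_simps)
qed

text \<open>The factor \<open>8 / (1 - 2 * c)\<close> is \<open>4 q\<close> for the exponent
  \<open>q = 2 / (1 - 2 * c)\<close>; the two summands bound the means of the two exponentials into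
  which the product is split.\<close>

definition young_const :: "real \<Rightarrow> real" where
  "young_const c = 8 / (1 - 2 * c) * (sqrt 2 + 1 / sqrt (1 - 4 * c / (1 + 2 * c)))"

text \<open>The two variables need not be jointly Gaussian: weighted AM-GM separates them.\<close>

lemma square_times_exp_square:
  assumes f: "centred_normal M s f" and g: "centred_normal M r g"
    and c: "0 \<le> c" "c < 1 / 2" and l: "0 \<le> l" "l * r\<^sup>2 \<le> c"
  shows "integrable M (\<lambda>\<omega>. (f \<omega>)\<^sup>2 * exp (l * (g \<omega>)\<^sup>2))"
    and "(\<integral>\<omega>. (f \<omega>)\<^sup>2 * exp (l * (g \<omega>)\<^sup>2) \<partial>M) \<le> young_const c * s\<^sup>2"
proof -
  have [measurable]: "f \<in> borel_measurable M" "g \<in> borel_measurable M"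
    using f g by (auto simp: centred_normal_def)
  \<comment> \<open>Conjugate exponents with \<open>p > 1\<close> but still
    \<open>p * c < 1 / 2\<close>, so that \<open>exp (p * l * g^2)\<close> keeps a finite
    mean.\<close>
  define p q where "p = 2 / (1 + 2 * c)" and "q = 2 / (1 - 2 * c)"
  have pq: "0 < p" "0 < q" "1 / p + 1 / q = 1"
    using c by (auto simp: p_def q_def field_simps)
  have pc: "p * c < 1 / 2" using c by (simp add: p_def field_simps)
  have pl: "p * l * r\<^sup>2 \<le> p * c"
    using l pq by (simp add: mult.assoc)
  \<comment> \<open>Dividing by a number \<open>A\<close> strictly above the variance of
    \<open>f\<close> also covers \<open>s = 0\<close>. The stated bound follows as \<open>A\<close>
    decreases to \<open>s^2\<close>.\<close>
  have main: "integrable M (\<lambda>\<omega>. (f \<omega>)\<^sup>2 * exp (l * (g \<omega>)\<^sup>2)) \<and>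
      (\<integral>\<omega>. (f \<omega>)\<^sup>2 * exp (l * (g \<omega>)\<^sup>2) \<partial>M) \<le> young_const c * A"
    if A: "s\<^sup>2 < A" for A
  proof -
    have A0: "0 < A" using A le_less_trans[OF zero_le_power2] by blast
    define b where "b \<omega> = 4 * q * A * (exp (1 / (4 * A) * (f \<omega>)\<^sup>2) + exp (p * l * (g \<omega>)\<^sup>2))" for \<omega>
    have le: "(f \<omega>)\<^sup>2 * exp (l * (g \<omega>)\<^sup>2) \<le> b \<omega>" for \<omega>
    proof -
      have "(f \<omega>)\<^sup>2 / A * exp (l * (g \<omega>)\<^sup>2) * A \<le>
          4 * q * (exp ((f \<omega>)\<^sup>2 / A / 4) + exp (p * (l * (g \<omega>)\<^sup>2))) * A"
        using A0 by (intro mult_right_mono mult_exp_le_exp_add_exp pq) auto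
      then show ?thesis using A0 by (simp add: b_def mult_ac)
    qed
    have sA: "1 / (4 * A) * s\<^sup>2 \<le> 1 / 4" using A A0 by (simp add: field_simps)
    note ef = centred_normal_exp_square[OF f, of "1 / (4 * A)"]
    note eg = centred_normal_exp_square[OF g, of "p * l"]
    have int: "integrable M (\<lambda>\<omega>. exp (1 / (4 * A) * (f \<omega>)\<^sup>2))" "integrable M (\<lambda>\<omega>. exp (p * l * (g \<omega>)\<^sup>2))"
      using ef(1) eg(1) sA pl pc by linarith+
    have intb: "integrable M b"
      unfolding b_def using int by (intro integrable_mult_right integrable_add) auto
    have int1: "integrable M (\<lambda>\<omega>. (f \<omega>)\<^sup>2 * exp (l * (g \<omega>)\<^sup>2))"
      by (rule Bochner_Integration.integrable_bound[OF intb]) (auto intro!: AE_I2 order_trans[OF le abs_ge_self])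
    have "(\<integral>\<omega>. (f \<omega>)\<^sup>2 * exp (l * (g \<omega>)\<^sup>2) \<partial>M) \<le> (\<integral>\<omega>. b \<omega> \<partial>M)"
      by (rule integral_mono[OF int1 intb le])
    also have "\<dots> = 4 * q * A * (1 / sqrt (1 - 2 * (1 / (4 * A)) * s\<^sup>2) + 1 / sqrt (1 - 2 * (p * l) * r\<^sup>2))"
      unfolding b_def using int ef(2) eg(2) sA pl pc by simp
    also have "\<dots> \<le> 4 * q * A * (1 / sqrt (1 / 2) + 1 / sqrt (1 - 2 * (p * c)))"
    proof (intro mult_left_mono add_mono)
      show "1 / sqrt (1 - 2 * (1 / (4 * A)) * s\<^sup>2) \<le> 1 / sqrt (1 / 2)"
        using sA by (intro divide_left_mono) auto
      show "1 / sqrt (1 - 2 * (p * l) * r\<^sup>2) \<le> 1 / sqrt (1 - 2 * (p * c))"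
        using pl pc by (intro divide_left_mono) auto
    qed (use pq A0 in auto)
    also have "\<dots> = young_const c * A"
      by (simp add: young_const_def p_def q_def real_sqrt_divide)
    finally show ?thesis using int1 by blast
  qed
  show "integrable M (\<lambda>\<omega>. (f \<omega>)\<^sup>2 * exp (l * (g \<omega>)\<^sup>2))"
    using main[of "s\<^sup>2 + 1"] by simp
  have yc: "0 < young_const c"
    using c by (auto simp: young_const_def field_simps intro!: mult_pos_pos add_pos_pos divide_pos_pos)
  show "(\<integral>\<omega>. (f \<omega>)\<^sup>2 * exp (l * (g \<omega>)\<^sup>2) \<partial>M) \<le> young_const c * s\<^sup>2"
  proof (rule field_le_epsilon)
    fix e :: real assume "0 < e"
    then show "(\<integral>\<omega>. (f \<omega>)\<^sup>2 * exp (l * (g \<omega>)\<^sup>2) \<partial>M) \<le> young_const c * s\<^sup>2 + e"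
      using main[of "s\<^sup>2 + e / young_const c"] yc by (simp add: algebra_simps)
  qed
qed

section \<open>Linear forms of a Gaussian vector\<close>

text \<open>The characteristic function of \<open>a . X\<close> at \<open>t\<close> is the defining
  formula of \<open>gaussian_vec\<close> at the vector \<open>t a\<close>; Levy's uniqueness theorem
  then identifies the law.\<close>

lemma gaussian_vec_linear:
  assumes X: "gaussian_vec M d S X" and S: "cov_mat d S" and a: "a \<in> carrier_vec d"
  shows "centred_normal M (sqrt (a \<bullet> (S *\<^sub>v a))) (\<lambda>\<omega>. a \<bullet> X \<omega>)"
proof -
  interpret prob_space M using X by (simp add: gaussian_vec_def)
  have Sc: "S \<in> carrier_mat d d" and A: "0 \<le> a \<bullet> (S *\<^sub>v a)"
    using S a by (auto simp: cov_mat_def)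
  have meas[measurable]: "(\<lambda>\<omega>. a \<bullet> X \<omega>) \<in> borel_measurable M"
    using X a by (simp add: gaussian_vec_def)
  have "distr M borel (\<lambda>\<omega>. a \<bullet> X \<omega>) =
      distr std_normal_distribution borel (\<lambda>z. sqrt (a \<bullet> (S *\<^sub>v a)) * z)"
  proof (rule Levy_uniqueness)
    show "real_distribution (distr M borel (\<lambda>\<omega>. a \<bullet> X \<omega>))"
      by (rule real_distribution_distr) simp
    interpret N: real_distribution std_normal_distribution by (rule real_dist_normal_dist)
    show "real_distribution (distr std_normal_distribution borel (\<lambda>z. sqrt (a \<bullet> (S *\<^sub>v a)) * z))"
      by (rule N.real_distribution_distr) simp
    show "char (distr M borel (\<lambda>\<omega>. a \<bullet> X \<omega>)) =
        char (distr std_normal_distribution borel (\<lambda>z. sqrt (a \<bullet> (S *\<^sub>v a)) * z))"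
    proof
      fix t :: real
      let ?b = "t \<cdot>\<^sub>v a"
      have b: "?b \<in> carrier_vec d" using a by simp
      have Xc: "X \<omega> \<in> carrier_vec d" if "\<omega> \<in> space M" for \<omega>
        using X that by (simp add: gaussian_vec_def)
      have "char (distr M borel (\<lambda>\<omega>. a \<bullet> X \<omega>)) t = (CLINT \<omega>|M. iexp (t * (a \<bullet> X \<omega>)))"
        unfolding char_def by (subst integral_distr) auto
      also have "\<dots> = (CLINT \<omega>|M. iexp (?b \<bullet> X \<omega>))"
        using a Xc by (intro Bochner_Integration.integral_cong refl) simp
      also have "\<dots> = exp (- complex_of_real (?b \<bullet> (S *\<^sub>v ?b)) / 2)"
        using X b by (simp add: gaussian_vec_def)
      also have "?b \<bullet> (S *\<^sub>v ?b) = t\<^sup>2 * (a \<bullet> (S *\<^sub>v a))"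
        using Sc a by (simp add: mult_mat_vec[of _ d d] power2_eq_square)
      also have "exp (- complex_of_real (t\<^sup>2 * (a \<bullet> (S *\<^sub>v a))) / 2) =
          char std_normal_distribution (t * sqrt (a \<bullet> (S *\<^sub>v a)))"
        unfolding char_std_normal_distribution exp_of_real[symmetric]
        using A by (simp add: power_mult_distrib flip: of_real_power)
      also have "\<dots> = char (distr std_normal_distribution borel (\<lambda>z. sqrt (a \<bullet> (S *\<^sub>v a)) * z)) t"
        unfolding char_def by (subst integral_distr) (auto simp: mult_ac)
      finally show "char (distr M borel (\<lambda>\<omega>. a \<bullet> X \<omega>)) t =
          char (distr std_normal_distribution borel (\<lambda>z. sqrt (a \<bullet> (S *\<^sub>v a)) * z)) t" .
    qed
  qed
  then show ?thesis using meas by (simp add: centred_normal_def)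
qed

section \<open>Soft and hard selection\<close>

abbreviation std_normal_prod :: "nat \<Rightarrow> (nat \<Rightarrow> real) measure" where
  "std_normal_prod k \<equiv> PiM {..<k} (\<lambda>_. std_normal_distribution)"

text \<open>Here \<open>z i\<close> is the deviation of the \<open>i\<close>-th sample from the mean
  shared by teacher and reward. Because the two weights coincide, error and negative reward are the
  same square.\<close>

definition softmin :: "nat \<Rightarrow> real \<Rightarrow> (nat \<Rightarrow> real) \<Rightarrow> real" where
  "softmin k T z = (\<Sum>i<k. (z i)\<^sup>2 * exp (- (z i)\<^sup>2 / T)) / (\<Sum>j<k. exp (- (z j)\<^sup>2 / T))"

definition min_sq :: "nat \<Rightarrow> (nat \<Rightarrow> real) \<Rightarrow> real" where
  "min_sq k z = Min ((\<lambda>i. (z i)\<^sup>2) ` {..<k})"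

text \<open>The zero-temperature error at an input with bias \<open>D\<close> and predictive
  standard deviation \<open>s\<close>.\<close>

definition mean_min_sq :: "nat \<Rightarrow> real \<Rightarrow> real \<Rightarrow> real" where
  "mean_min_sq k D s = (\<integral>e. min_sq k (\<lambda>i. D + s * e i) \<partial>std_normal_prod k)"

lemma prob_space_std_normal: "prob_space std_normal_distribution"
  using real_dist_normal_dist by (simp add: real_distribution_def)

lemma prob_space_std_normal_prod: "prob_space (std_normal_prod k)"
  by (intro prob_space_PiM prob_space_std_normal)

section \<open>Comparison of soft and hard minimum\<close>

lemma min_sq_le: "i < k \<Longrightarrow> min_sq k z \<le> (z i)\<^sup>2"
  unfolding min_sq_def by (intro Min_le) auto

lemma min_sq_attained:
  assumes "1 \<le> k" obtains i where "i < k" "min_sq k z = (z i)\<^sup>2"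
proof -
  have "min_sq k z \<in> (\<lambda>i. (z i)\<^sup>2) ` {..<k}"
    using assms unfolding min_sq_def by (intro Min_in) (auto simp: lessThan_empty_iff)
  then show thesis using that by blast
qed

lemma min_sq_nonneg: "1 \<le> k \<Longrightarrow> 0 \<le> min_sq k z"
  by (rule min_sq_attained[of k z]) auto

text \<open>After cancelling \<open>exp (- m / T)\<close>, with \<open>m\<close> the minimum, the
  denominator is at least 1, because the minimiser contributes exactly 1. Each term of the excess
  over \<open>m\<close> has the form \<open>T * (v * exp (- v))\<close> with \<open>v\<close>
  nonnegative, hence is at most \<open>T\<close>.\<close>

lemma softmin_bounds:
  assumes k: "1 \<le> k" and T: "0 < T"
  shows "min_sq k z \<le> softmin k T z" and "softmin k T z \<le> min_sq k z + real k * T"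
proof -
  define m where "m = min_sq k z"
  define c where "c i = exp (- ((z i)\<^sup>2 - m) / T)" for i
  have m: "m \<le> (z i)\<^sup>2" if "i < k" for i using min_sq_le[OF that] by (simp add: m_def)
  have c: "exp (- (z i)\<^sup>2 / T) = exp (- m / T) * c i" for i
    by (simp add: c_def exp_add[symmetric] diff_divide_distrib add_divide_distrib)
  obtain j where j: "j < k" "m = (z j)\<^sup>2" using min_sq_attained[OF k, of z] by (auto simp: m_def)
  have "c j \<le> sum c {..<k}"
    using j(1) by (intro member_le_sum) (auto simp: c_def)
  moreover have "c j = 1" by (simp add: c_def j(2))
  ultimately have C: "1 \<le> sum c {..<k}" by simp
  have "softmin k T z = (exp (- m / T) * (\<Sum>i<k. (z i)\<^sup>2 * c i)) / (exp (- m / T) * sum c {..<k})"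
    unfolding softmin_def c by (simp add: sum_distrib_left sum_distrib_right mult_ac)
  also have "\<dots> = (\<Sum>i<k. (z i)\<^sup>2 * c i) / sum c {..<k}" by simp
  finally have eq: "softmin k T z - m = (\<Sum>i<k. ((z i)\<^sup>2 - m) * c i) / sum c {..<k}"
    using C by (simp add: left_diff_distrib sum_subtractf sum_distrib_left[symmetric] diff_divide_distrib)
  have num0: "0 \<le> (\<Sum>i<k. ((z i)\<^sup>2 - m) * c i)"
    using m by (intro sum_nonneg mult_nonneg_nonneg) (auto simp: c_def)
  have "0 \<le> softmin k T z - m" unfolding eq using num0 C by (intro divide_nonneg_pos) auto
  then show "min_sq k z \<le> softmin k T z" by (simp add: m_def)
  have "((z i)\<^sup>2 - m) * c i \<le> T" for i
  proof -
    let ?u = "((z i)\<^sup>2 - m) / T"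
    have "?u \<le> exp ?u" using exp_ge_add_one_self[of ?u] by linarith
    then have "?u * exp (- ?u) \<le> exp ?u * exp (- ?u)" by (intro mult_right_mono) auto
    then have "?u * exp (- ?u) \<le> 1" by (simp add: exp_minus)
    moreover have "exp (- ?u) = c i" by (simp only: c_def minus_divide_left)
    ultimately show ?thesis using T by (simp add: field_simps)
  qed
  then have num: "(\<Sum>i<k. ((z i)\<^sup>2 - m) * c i) \<le> real k * T"
    using sum_bounded_above[of "{..<k}" "\<lambda>i. ((z i)\<^sup>2 - m) * c i" T] by simp
  have "softmin k T z - m \<le> (\<Sum>i<k. ((z i)\<^sup>2 - m) * c i) / 1"
    unfolding eq using C num0 by (intro divide_left_mono) auto
  then show "softmin k T z \<le> min_sq k z + real k * T"
    using num by (simp add: m_def)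
qed

section \<open>Expectations under independent standard normals\<close>

lemma std_normal_prod_component:
  fixes h :: "real \<Rightarrow> real"
  assumes "i < k" and [measurable]: "h \<in> borel_measurable borel"
  shows "integrable (std_normal_prod k) (\<lambda>e. h (e i)) \<longleftrightarrow> integrable std_normal_distribution h"
    and "(\<integral>e. h (e i) \<partial>std_normal_prod k) = (\<integral>z. h z \<partial>std_normal_distribution)"
proof -
  have [measurable]: "i \<in> {..<k}" using assms by simp
  have eq: "distr (std_normal_prod k) std_normal_distribution (\<lambda>e. e i) = std_normal_distribution"
    using assms by (intro distr_PiM_component prob_space_std_normal) auto
  show "integrable (std_normal_prod k) (\<lambda>e. h (e i)) \<longleftrightarrow> integrable std_normal_distribution h"
    by (subst (2) eq[symmetric], subst integrable_distr_eq) auto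
  show "(\<integral>e. h (e i) \<partial>std_normal_prod k) = (\<integral>z. h z \<partial>std_normal_distribution)"
    by (subst (2) eq[symmetric], subst integral_distr) auto
qed

lemma std_normal_affine_square:
  "integrable std_normal_distribution (\<lambda>z. (D + s * z)\<^sup>2)"
  "(\<integral>z. (D + s * z)\<^sup>2 \<partial>std_normal_distribution) = D\<^sup>2 + s\<^sup>2"
proof -
  interpret prob_space std_normal_distribution by (rule prob_space_std_normal)
  have 1: "has_bochner_integral std_normal_distribution (\<lambda>z. z) 0"
    using std_normal_moment_odd[of 0] by (simp add: has_bochner_integral_density)
  have 2: "has_bochner_integral std_normal_distribution (\<lambda>z. z\<^sup>2) 1"
    using std_normal_moment_even[of 1] by (simp add: has_bochner_integral_density)
  have 0: "has_bochner_integral std_normal_distribution (\<lambda>z. D\<^sup>2) (D\<^sup>2)"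
    using prob_space by (simp add: has_bochner_integral_iff)
  have "has_bochner_integral std_normal_distribution (\<lambda>z. D\<^sup>2 + (2 * D * s) * z + s\<^sup>2 * z\<^sup>2)
      (D\<^sup>2 + (2 * D * s) * 0 + s\<^sup>2 * 1)"
    by (intro has_bochner_integral_add has_bochner_integral_mult_right 0 1 2)
  moreover have "(D + s * z)\<^sup>2 = D\<^sup>2 + (2 * D * s) * z + s\<^sup>2 * z\<^sup>2" for z
    by (simp add: power2_eq_square algebra_simps)
  ultimately show "integrable std_normal_distribution (\<lambda>z. (D + s * z)\<^sup>2)"
    "(\<integral>z. (D + s * z)\<^sup>2 \<partial>std_normal_distribution) = D\<^sup>2 + s\<^sup>2"
    by (simp_all add: has_bochner_integral_iff)
qed

lemma borel_measurable_min_sq [measurable (raw)]: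
  assumes "\<And>i. i < k \<Longrightarrow> (\<lambda>x. f x i) \<in> borel_measurable M"
  shows "(\<lambda>x. min_sq k (f x)) \<in> borel_measurable M"
  unfolding min_sq_def using assms by (intro borel_measurable_Min) auto

lemma borel_measurable_softmin [measurable (raw)]:
  assumes "\<And>i. i < k \<Longrightarrow> (\<lambda>x. f x i) \<in> borel_measurable M"
  shows "(\<lambda>x. softmin k T (f x)) \<in> borel_measurable M"
  unfolding softmin_def using assms by (intro borel_measurable_divide borel_measurable_sum) auto

lemma measurable_component_std_normal_prod [measurable]:
  "i < k \<Longrightarrow> (\<lambda>e. e i) \<in> borel_measurable (std_normal_prod k)"
  using measurable_component_singleton[of i "{..<k}" "\<lambda>_. std_normal_distribution"] by simp

lemma min_sq_integrable:
  assumes "1 \<le> k"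
  shows "integrable (std_normal_prod k) (\<lambda>e. min_sq k (\<lambda>i. D + s * e i))"
    and "0 \<le> mean_min_sq k D s" and "mean_min_sq k D s \<le> D\<^sup>2 + s\<^sup>2"
proof -
  have 0: "0 < k" using assms by simp
  have int: "integrable (std_normal_prod k) (\<lambda>e. (D + s * e 0)\<^sup>2)"
    using std_normal_prod_component(1)[OF 0, of "\<lambda>z. (D + s * z)\<^sup>2"] std_normal_affine_square by simp
  show *: "integrable (std_normal_prod k) (\<lambda>e. min_sq k (\<lambda>i. D + s * e i))"
    by (rule Bochner_Integration.integrable_bound[OF int])
      (use min_sq_le[OF 0] min_sq_nonneg[OF assms] in \<open>auto intro!: AE_I2\<close>)
  show "0 \<le> mean_min_sq k D s"
    unfolding mean_min_sq_def by (intro Bochner_Integration.integral_nonneg min_sq_nonneg assms)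
  have "mean_min_sq k D s \<le> (\<integral>e. (D + s * e 0)\<^sup>2 \<partial>std_normal_prod k)"
    unfolding mean_min_sq_def by (rule integral_mono[OF * int]) (rule min_sq_le[OF 0])
  also have "\<dots> = D\<^sup>2 + s\<^sup>2"
    using std_normal_prod_component(2)[OF 0, of "\<lambda>z. (D + s * z)\<^sup>2"] std_normal_affine_square by simp
  finally show "mean_min_sq k D s \<le> D\<^sup>2 + s\<^sup>2" .
qed

text \<open>The gap \<open>k * T\<close> depends on neither \<open>D\<close> nor \<open>s\<close>,
  so the limit in \<open>T\<close> is uniform over inputs and can be taken outside the
  average.\<close>

lemma mean_softmin_bounds:
  fixes D s :: real
  assumes k: "1 \<le> k" and T: "0 < T"
  defines "q \<equiv> (\<integral>e. softmin k T (\<lambda>i. D + s * e i) \<partial>std_normal_prod k)"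
  shows "mean_min_sq k D s \<le> q" and "q \<le> mean_min_sq k D s + real k * T"
proof -
  interpret prob_space "std_normal_prod k" by (rule prob_space_std_normal_prod)
  note int = min_sq_integrable(1)[OF k, of D s]
  have int2: "integrable (std_normal_prod k) (\<lambda>e. min_sq k (\<lambda>i. D + s * e i) + real k * T)"
    using int by simp
  have "integrable (std_normal_prod k) (\<lambda>e. softmin k T (\<lambda>i. D + s * e i))"
    by (rule Bochner_Integration.integrable_bound[OF int2])
      (use order_trans[OF min_sq_nonneg[OF k] softmin_bounds(1)[OF k T]] softmin_bounds(2)[OF k T]
        in \<open>auto intro!: AE_I2 intro: order_trans[OF _ abs_ge_self]\<close>)
  note le = this
  show "mean_min_sq k D s \<le> q"
    unfolding mean_min_sq_def q_def by (rule integral_mono[OF int le]) (rule softmin_bounds(1)[OF k T])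
  have "q \<le> (\<integral>e. min_sq k (\<lambda>i. D + s * e i) + real k * T \<partial>std_normal_prod k)"
    unfolding q_def by (rule integral_mono[OF le int2]) (rule softmin_bounds(2)[OF k T])
  also have "\<dots> = mean_min_sq k D s + real k * T"
    using int prob_space by (simp add: mean_min_sq_def)
  finally show "q \<le> mean_min_sq k D s + real k * T" .
qed

lemma borel_measurable_mean_min_sq:
  assumes [measurable]: "D \<in> borel_measurable M" "s \<in> borel_measurable M"
  shows "(\<lambda>\<omega>. mean_min_sq k (D \<omega>) (s \<omega>)) \<in> borel_measurable M"
proof -
  interpret prob_space "std_normal_prod k" by (rule prob_space_std_normal_prod)
  show ?thesis unfolding mean_min_sq_def
    by (rule borel_measurable_lebesgue_integral) measurable
qed

lemma borel_measurable_mean_softmin: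
  assumes [measurable]: "D \<in> borel_measurable M" "s \<in> borel_measurable M"
  shows "(\<lambda>\<omega>. \<integral>e. softmin k T (\<lambda>i. D \<omega> + s \<omega> * e i) \<partial>std_normal_prod k) \<in> borel_measurable M"
proof -
  interpret prob_space "std_normal_prod k" by (rule prob_space_std_normal_prod)
  show ?thesis
    by (rule borel_measurable_lebesgue_integral) measurable
qed

text \<open>Samples from the predictive law are \<open>m + s * e i\<close> with independent standard
  normal \<open>e i\<close>: the product measure is the image of the standard one under a
  coordinatewise affine map. This puts the dependence on \<open>x\<close> into the integrand instead
  of the measure.\<close>

lemma gen_err_at_eq_softmin:
  assumes pos: "0 < pred_var d S R \<sigma> \<gamma> x"
  shows "gen_err_at d S R \<sigma> \<gamma> w w k T x =
    (\<integral>e. softmin k T (\<lambda>i. (pred_mean d S R w x - lin_mean d w x)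
        + sqrt (pred_var d S R \<sigma> \<gamma> x) * e i) \<partial>std_normal_prod k)"
proof -
  let ?m = "pred_mean d S R w x" and ?s = "sqrt (pred_var d S R \<sigma> \<gamma> x)" and ?\<mu> = "lin_mean d w x"
  let ?N = "density lborel (normal_density ?m ?s)"
  define f where "f z = ?m + ?s * z" for z
  have s: "0 < ?s" using pos by simp
  interpret std: prob_space std_normal_distribution by (rule prob_space_std_normal)
  have "distributed std_normal_distribution lborel (\<lambda>z. z) std_normal_density"
    by (auto simp: distributed_def distr_id2)
  from std.normal_density_affine[OF this, of ?s ?m] s
  have "distributed std_normal_distribution lborel f (normal_density ?m ?s)"
    by (simp add: f_def[abs_def])
  then have "distr std_normal_distribution lborel f = ?N"
    by (simp add: distributed_def)
  \<comment> \<open>For an image measure only the sigma-algebra of the target matters; taking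
    \<open>?N\<close> as target matches the formula for product laws.\<close>
  then have N: "distr std_normal_distribution ?N f = ?N"
    by (metis distr_cong sets_density)
  have fm[measurable]: "f \<in> measurable std_normal_distribution ?N" by (simp add: f_def[abs_def])
  have "PiM {..<k} (\<lambda>_. ?N) = PiM {..<k} (\<lambda>_. distr std_normal_distribution ?N f)"
    by (simp add: N)
  also have "\<dots> = distr (std_normal_prod k) (PiM {..<k} (\<lambda>_. ?N)) (compose {..<k} f)"
    by (rule distr_PiM_finite_prob_space'[symmetric])
      (use fm in \<open>simp_all add: prob_space_std_normal prob_space_normal_density[OF s]\<close>)
  finally have P: "PiM {..<k} (\<lambda>_. ?N) = distr (std_normal_prod k) (PiM {..<k} (\<lambda>_. ?N)) (compose {..<k} f)" .
  have cm[measurable]: "compose {..<k} f \<in> measurable (std_normal_prod k) (PiM {..<k} (\<lambda>_. ?N))"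
    unfolding compose_def
    by (rule measurable_restrict, rule measurable_compose[OF _ fm],
      rule measurable_component_singleton)
  have ym: "(\<lambda>y. y i) \<in> borel_measurable (PiM {..<k} (\<lambda>_. ?N))" if "i < k" for i
    using measurable_component_singleton[of i "{..<k}" "\<lambda>_. ?N"] that by simp
  have "gen_err_at d S R \<sigma> \<gamma> w w k T x = (\<integral>y. softmin k T (\<lambda>i. y i - ?\<mu>) \<partial>PiM {..<k} (\<lambda>_. ?N))"
    by (simp add: gen_err_at_def softmin_def reward_def)
  also have "\<dots> = (\<integral>e. softmin k T (\<lambda>i. compose {..<k} f e i - ?\<mu>) \<partial>std_normal_prod k)"
    by (subst P, subst integral_distr[OF cm]) (use ym in \<open>auto intro!: borel_measurable_softmin\<close>)
  also have "\<dots> = (\<integral>e. softmin k T (\<lambda>i. (?m - ?\<mu>) + ?s * e i) \<partial>std_normal_prod k)"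
    by (rule Bochner_Integration.integral_cong) (auto simp: softmin_def compose_def f_def algebra_simps)
  finally show ?thesis .
qed

section \<open>The minimum of many shifted Gaussians\<close>

definition normal_tail :: "real \<Rightarrow> real \<Rightarrow> real" where
  "normal_tail a r = measure std_normal_distribution {e. r \<le> \<bar>a + e\<bar>}"

lemma normal_tail_bounds: "0 \<le> normal_tail a r" "normal_tail a r \<le> 1"
proof -
  interpret prob_space std_normal_distribution by (rule prob_space_std_normal)
  show "0 \<le> normal_tail a r" "normal_tail a r \<le> 1" by (simp_all add: normal_tail_def)
qed

lemma normal_tail_antimono: "r \<le> r' \<Longrightarrow> normal_tail a r' \<le> normal_tail a r"
proof -
  interpret prob_space std_normal_distribution by (rule prob_space_std_normal)
  show "r \<le> r' \<Longrightarrow> normal_tail a r' \<le> normal_tail a r"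
    unfolding normal_tail_def by (intro finite_measure_mono) (auto intro: order_trans)
qed

lemma borel_measurable_normal_tail [measurable]: "normal_tail a \<in> borel_measurable borel"
proof -
  have "mono (\<lambda>r. - normal_tail a r)" by (intro monoI) (simp add: normal_tail_antimono)
  then have "(\<lambda>r. - (- normal_tail a r)) \<in> borel_measurable borel"
    by (intro borel_measurable_uminus borel_measurable_mono)
  then show ?thesis by simp
qed

text \<open>Complement plus the substitution \<open>t = a + e\<close>. In this form the window is
  centred at the origin, and the behaviour for small \<open>r\<close> can be read off from the
  density near \<open>- a\<close>.\<close>

lemma normal_tail_eq_integral:
  "integrable lborel (\<lambda>t. indicator {- r<..<r} t * std_normal_density (t - a))"
  "normal_tail a r = 1 - (\<integral>t. indicator {- r<..<r} t * std_normal_density (t - a) \<partial>lborel)"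
proof -
  interpret prob_space std_normal_distribution by (rule prob_space_std_normal)
  let ?A = "{e. \<bar>a + e\<bar> < r}"
  let ?f = "\<lambda>e. indicator ?A e * std_normal_density e"
  have "integrable lborel ?f"
    by (rule Bochner_Integration.integrable_bound[OF integrable_normal_density[of 1 0]])
      (auto simp: indicator_def)
  from lborel_integrable_real_affine[OF this, of 1 "-a"]
  have i: "integrable lborel (\<lambda>t. ?f (- a + 1 * t))" by simp
  have e: "?f (- a + 1 * t) = indicator {- r<..<r} t * std_normal_density (t - a)" for t
    by (auto simp: indicator_def normal_density_def abs_less_iff)
  show "integrable lborel (\<lambda>t. indicator {- r<..<r} t * std_normal_density (t - a))"
    using i unfolding e .
  have "{e. r \<le> \<bar>a + e\<bar>} = space std_normal_distribution - ?A" by auto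
  then have "normal_tail a r = 1 - measure std_normal_distribution ?A"
    unfolding normal_tail_def by (simp only:) (rule prob_compl, simp)
  also have "measure std_normal_distribution ?A = (\<integral>e. indicator ?A e \<partial>std_normal_distribution)"
    by simp
  also have "\<dots> = (\<integral>e. ?f e \<partial>lborel)"
    by (subst integral_density) (auto simp: mult_ac)
  also have "\<dots> = (\<integral>t. ?f (- a + 1 * t) \<partial>lborel)"
    by (subst lborel_integral_real_affine[where c=1 and t="-a"]) auto
  finally show "normal_tail a r = 1 - (\<integral>t. indicator {- r<..<r} t * std_normal_density (t - a) \<partial>lborel)"
    unfolding e .
qed

text \<open>Only the half of the window on the same side as \<open>a\<close> is used. There
  \<open>a * t\<close> is nonnegative, so the density loses at most \<open>exp (- 1 / 2)\<close>
  against its value at \<open>a\<close>; the other half could lose a factor exponential in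
  \<open>\<bar>a\<bar>\<close>.\<close>

lemma normal_tail_le_small:
  assumes r: "0 \<le> r" "r \<le> 1"
  shows "normal_tail a r \<le> 1 - std_normal_density a * exp (- 1 / 2) * r"
proof -
  define J where "J = (if 0 \<le> a then {0<..<r} else {- r<..<0})"
  define c where "c = std_normal_density a * exp (- 1 / 2)"
  have "J \<in> sets borel" "measure lborel J = r" "emeasure lborel J < \<infinity>"
    using r by (auto simp: J_def)
  then have int: "integrable lborel (\<lambda>t. indicator J t * c)" "(\<integral>t. indicator J t * c \<partial>lborel) = r * c"
    by auto
  have "(\<integral>t. indicator J t * c \<partial>lborel) \<le> (\<integral>t. indicator {- r<..<r} t * std_normal_density (t - a) \<partial>lborel)"
  proof (rule integral_mono[OF int(1) normal_tail_eq_integral(1)])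
    fix t
    show "indicator J t * c \<le> indicator {- r<..<r} t * std_normal_density (t - a)"
    proof (cases "t \<in> J")
      case True
      then have t: "t \<in> {- r<..<r}" "0 \<le> a * t" "\<bar>t\<bar> \<le> 1"
        using r by (auto simp: J_def mult_nonneg_nonneg mult_nonpos_nonpos split: if_splits)
      have "(t - a)\<^sup>2 = t\<^sup>2 - 2 * (a * t) + a\<^sup>2" by (simp add: power2_eq_square algebra_simps)
      also have "\<dots> \<le> 1 + a\<^sup>2"
        using t abs_le_square_iff[of t 1] by simp
      finally have "- 1 / 2 - a\<^sup>2 / 2 \<le> - (t - a)\<^sup>2 / 2" by simp
      then have "exp (- a\<^sup>2 / 2) * exp (- 1 / 2) \<le> exp (- (t - a)\<^sup>2 / 2)"
        by (simp add: exp_add[symmetric])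
      then have "c \<le> std_normal_density (t - a)"
        unfolding c_def std_normal_density_def by (simp add: divide_right_mono)
      then show ?thesis using True t by simp
    qed simp
  qed
  then have "r * c \<le> 1 - normal_tail a r"
    unfolding int(2) normal_tail_eq_integral(2) by simp
  then show ?thesis by (simp add: c_def mult_ac)
qed

text \<open>Markov's inequality for the fourth power, with \<open>(a + e)^4 <= 8 a^4 + 8 e^4\<close>
  and fourth moment 3 of the standard normal.\<close>

lemma normal_tail_le_large:
  assumes r: "0 < r"
  shows "normal_tail a r \<le> (2 * (\<bar>a\<bar> + 2) / r) ^ 4"
proof -
  interpret prob_space std_normal_distribution by (rule prob_space_std_normal)
  have 4: "has_bochner_integral std_normal_distribution (\<lambda>z. z ^ 4) 3"
    using std_normal_moment_even[of 2] by (simp add: has_bochner_integral_density fact_numeral)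
  have "has_bochner_integral std_normal_distribution (\<lambda>z. 8 * a ^ 4 + 8 * z ^ 4) (8 * a ^ 4 + 8 * 3)"
    using prob_space
    by (intro has_bochner_integral_add has_bochner_integral_mult_right 4)
      (simp add: has_bochner_integral_iff)
  then have b: "integrable std_normal_distribution (\<lambda>z. (8 * a ^ 4 + 8 * z ^ 4) / r ^ 4)"
    "(\<integral>z. (8 * a ^ 4 + 8 * z ^ 4) / r ^ 4 \<partial>std_normal_distribution) = (8 * a ^ 4 + 8 * 3) / r ^ 4"
    by (auto simp: has_bochner_integral_iff)
  let ?A = "{e. r \<le> \<bar>a + e\<bar>}"
  have "normal_tail a r = (\<integral>e. indicator ?A e \<partial>std_normal_distribution)"
    by (simp add: normal_tail_def)
  also have "\<dots> \<le> (\<integral>z. (8 * a ^ 4 + 8 * z ^ 4) / r ^ 4 \<partial>std_normal_distribution)"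
  proof (rule integral_mono[OF _ b(1)])
    show "integrable std_normal_distribution (indicator ?A :: real \<Rightarrow> real)"
      by (simp add: less_top[symmetric])
    fix e :: real
    show "indicator ?A e \<le> (8 * a ^ 4 + 8 * e ^ 4) / r ^ 4"
    proof (cases "e \<in> ?A")
      case True
      then have "r ^ 4 \<le> \<bar>a + e\<bar> ^ 4" using r by (intro power_mono) auto
      also have "\<dots> = ((a + e)\<^sup>2)\<^sup>2" by simp
      also have "\<dots> \<le> (2 * a\<^sup>2 + 2 * e\<^sup>2)\<^sup>2"
        using sum_squares_bound[of a e] sum_squares_bound[of a "- e"] by (intro power_mono) (auto simp: power2_sum)
      also have "\<dots> \<le> 8 * a ^ 4 + 8 * e ^ 4"
        using sum_squares_bound[of "a\<^sup>2" "e\<^sup>2"] by (simp add: power2_sum power_mult_distrib)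
      finally show ?thesis using True r by simp
    qed (use r in simp)
  qed
  also have "\<dots> = (8 * a ^ 4 + 8 * 3) / r ^ 4" by (rule b(2))
  also have "\<dots> \<le> (2 * (\<bar>a\<bar> + 2)) ^ 4 / r ^ 4"
  proof (rule divide_right_mono)
    have "8 * a ^ 4 + 8 * 3 \<le> 16 * (\<bar>a\<bar> ^ 4 + 2 ^ 4)" by simp
    also have "\<bar>a\<bar> ^ 4 + 2 ^ 4 \<le> (\<bar>a\<bar> + 2) ^ 4"
    proof -
      have "b ^ 4 + 2 ^ 4 \<le> (b + 2) ^ 4" if "0 \<le> b" for b :: real
        using that unfolding power4_eq_xxxx by (simp add: algebra_simps)
      from this[of "\<bar>a\<bar>"] show ?thesis by simp
    qed
    finally show "8 * a ^ 4 + 8 * 3 \<le> (2 * (\<bar>a\<bar> + 2)) ^ 4"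
      unfolding power_mult_distrib by simp
  qed (use r in simp)
  also have "\<dots> = (2 * (\<bar>a\<bar> + 2) / r) ^ 4" by (simp add: power_divide)
  finally show ?thesis by simp
qed

text \<open>The slope of the bound for small \<open>r\<close>, reduced by a factor linear in
  \<open>\<bar>a\<bar>\<close> so that one rate serves small and large \<open>r\<close>
  alike.\<close>

definition tail_rate :: "real \<Rightarrow> real" where
  "tail_rate a = std_normal_density a * exp (- 1 / 2) / (16 * (\<bar>a\<bar> + 2))"

lemma tail_rate_pos: "0 < tail_rate a"
  by (auto simp: tail_rate_def normal_density_pos intro!: divide_pos_pos mult_pos_pos add_nonneg_pos)

text \<open>Any exponent above 2 makes the bound integrable against \<open>2 r\<close>; 4 needs only an even moment.\<close>

lemma normal_tail_le_power:
  assumes r: "0 \<le> r"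
  shows "normal_tail a r \<le> 1 / (1 + tail_rate a * r) ^ 4"
proof -
  define c where "c = std_normal_density a * exp (- 1 / 2)"
  define m where "m = 2 * (\<bar>a\<bar> + 2)"
  have m: "4 \<le> m" by (simp add: m_def)
  have h: "tail_rate a = c / (8 * m)" by (simp add: tail_rate_def c_def m_def)
  have c: "0 < c" by (simp add: c_def normal_density_pos)
  have "c \<le> 1 * 1"
    unfolding c_def
  proof (rule mult_mono)
    have "1 / sqrt (2 * pi) \<le> 1" using pi_gt3 by simp
    then have "1 / sqrt (2 * pi) * exp (- a\<^sup>2 / 2) \<le> 1 * 1"
      by (intro mult_mono) auto
    then show "std_normal_density a \<le> 1" by (simp add: std_normal_density_def)
  qed auto
  then have c1: "c \<le> 1" by simp
  have hp: "0 < tail_rate a" by (rule tail_rate_pos)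
  have exp4: "(1 + tail_rate a * r) ^ 4 \<le> exp (4 * tail_rate a * r)"
  proof -
    have "(1 + tail_rate a * r) ^ 4 \<le> exp (tail_rate a * r) ^ 4"
      using hp r by (intro power_mono) auto
    then show ?thesis by (simp add: exp_of_nat_mult[symmetric] mult_ac)
  qed
  have inv: "exp (- (4 * tail_rate a * r)) \<le> 1 / (1 + tail_rate a * r) ^ 4"
    unfolding exp_minus inverse_eq_divide using exp4 hp r
    by (intro divide_left_mono) (auto intro!: mult_pos_pos zero_less_power add_pos_nonneg)
  \<comment> \<open>From \<open>2 * m\<close> on, the fourth-moment bound \<open>(m / r)^4\<close>
    is already small enough. Below it, \<open>r / (2 * m) <= min r 1\<close> lets the exponential of
    the small-\<open>r\<close> slope absorb the whole range.\<close>
  show ?thesis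
  proof (cases "2 * m \<le> r")
    case True
    then have rp: "0 < r" using m by linarith
    have "m * tail_rate a = c / 8" using m by (simp add: h)
    then have "m * tail_rate a \<le> 1 / 2" using c1 by simp
    then have "m * tail_rate a * r \<le> 1 / 2 * r" using rp by (intro mult_right_mono) auto
    then have "m * (1 + tail_rate a * r) \<le> r" using True by (simp add: algebra_simps)
    then have "m / r \<le> 1 / (1 + tail_rate a * r)"
      using rp hp by (simp add: field_simps add_pos_pos)
    then have "(m / r) ^ 4 \<le> (1 / (1 + tail_rate a * r)) ^ 4"
      using m rp by (intro power_mono) auto
    then show ?thesis
      using normal_tail_le_large[OF rp, of a] by (simp add: m_def power_divide)
  next
    case False
    have "normal_tail a r \<le> normal_tail a (min r 1)" by (rule normal_tail_antimono) simp
    also have "\<dots> \<le> 1 - c * min r 1"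
      using normal_tail_le_small[of "min r 1" a] r by (simp add: c_def)
    also have "\<dots> \<le> exp (- (c * min r 1))"
      using exp_ge_add_one_self[of "- (c * min r 1)"] by simp
    also have "\<dots> \<le> exp (- (4 * tail_rate a * r))"
    proof -
      have "4 * tail_rate a * r = c * (r / (2 * m))" by (simp add: h)
      also have "r / (2 * m) \<le> min r 1"
        using False m r mult_left_mono[of 1 "2 * m" r] by (auto simp: field_simps)
      finally show ?thesis using c by simp
    qed
    also note inv
    finally show ?thesis .
  qed
qed

text \<open>Bernoulli's inequality gives \<open>(1 + h * r / k)^k >= 1 + h * r\<close>, which
  removes \<open>k\<close> from the bound and yields one dominating function for all sample
  sizes.\<close>

lemma normal_tail_power_le:
  assumes r: "0 \<le> r" and k: "1 \<le> k"
  shows "normal_tail a (r / real k) ^ k \<le> 1 / (1 + tail_rate a * r) ^ 4"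
proof -
  have hp: "0 < tail_rate a" by (rule tail_rate_pos)
  let ?b = "1 + tail_rate a * (r / real k)"
  have b: "0 < ?b" using hp r by (intro add_pos_nonneg) auto
  have "normal_tail a (r / real k) ^ k \<le> (1 / ?b ^ 4) ^ k"
    using normal_tail_bounds r by (intro power_mono normal_tail_le_power) auto
  moreover have "(1 / ?b ^ 4) ^ k = 1 / (?b ^ k) ^ 4"
  proof -
    have "(x ^ 4) ^ k = (x ^ k) ^ 4" for x :: real by (metis power_mult mult.commute)
    then show ?thesis by (simp only: power_divide power_one)
  qed
  moreover have "1 / (?b ^ k) ^ 4 \<le> 1 / (1 + tail_rate a * r) ^ 4"
  proof (rule divide_left_mono)
    have "-1 \<le> tail_rate a * (r / real k)"
      by (rule order_trans[of _ 0]) (use hp r in auto)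
    then have "1 + real k * (tail_rate a * (r / real k)) \<le> ?b ^ k"
      by (rule Bernoulli_inequality)
    then have "1 + tail_rate a * r \<le> ?b ^ k" using k by simp
    then show "(1 + tail_rate a * r) ^ 4 \<le> (?b ^ k) ^ 4"
      using hp r by (intro power_mono) auto
    show "0 < (?b ^ k) ^ 4 * (1 + tail_rate a * r) ^ 4"
      using hp r b by (intro mult_pos_pos zero_less_power add_pos_nonneg) auto
  qed simp
  ultimately show ?thesis by linarith
qed

section \<open>Two explicit integrals\<close>

lemma nn_integral_rational_tail:
  assumes h: "0 < h"
  shows "(\<integral>\<^sup>+r. ennreal (2 * r / (1 + h * r) ^ 4) * indicator {0..} r \<partial>lborel) = ennreal (1 / (3 * h\<^sup>2))"
proof -
  \<comment> \<open>With \<open>u = 1 + h * r\<close> the integrand is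
    \<open>2 / h * (u^(-3) - u^(-4))\<close>; \<open>F\<close> is its antiderivative vanishing at
    infinity.\<close>
  define F where "F r = 2 / h\<^sup>2 * (1 / (3 * (1 + h * r) ^ 3) - 1 / (2 * (1 + h * r)\<^sup>2))" for r
  have "(\<integral>\<^sup>+r. ennreal (2 * r / (1 + h * r) ^ 4) * indicator {0..} r \<partial>lborel) = ennreal (0 - F 0)"
  proof (rule nn_integral_FTC_atLeast)
    fix r :: real assume r: "0 \<le> r"
    then have p: "0 < 1 + h * r" using h by (intro add_pos_nonneg) auto
    define u where "u = 1 + h * r"
    have u: "0 < u" "r = (u - 1) / h" using p h by (auto simp: u_def)
    have "(F has_real_derivative
        2 / h\<^sup>2 * (- (3 * h * u\<^sup>2 * 3) / (3 * u ^ 3)\<^sup>2 + (2 * h * u * 2) / (2 * u\<^sup>2)\<^sup>2)) (at r)"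
      unfolding F_def u_def using p h
      by (auto intro!: derivative_eq_intros simp: power2_eq_square)
    moreover have "2 / h\<^sup>2 * (- (3 * h * u\<^sup>2 * 3) / (3 * u ^ 3)\<^sup>2 + (2 * h * u * 2) / (2 * u\<^sup>2)\<^sup>2) =
        2 * r / u ^ 4"
      unfolding u(2) using u(1) h by (simp add: field_simps power2_eq_square power3_eq_cube power4_eq_xxxx)
    ultimately show "(F has_real_derivative 2 * r / (1 + h * r) ^ 4) (at r)"
      by (simp add: u_def)
    show "0 \<le> 2 * r / (1 + h * r) ^ 4" using r by simp
  next
    show "(F \<longlongrightarrow> 0) at_top" unfolding F_def using h by real_asymp
  qed simp
  also have "0 - F 0 = 1 / (3 * h\<^sup>2)" by (simp add: F_def)
  finally show ?thesis .
qed

lemma nn_integral_exp_tail: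
  assumes l: "0 < l"
  shows "(\<integral>\<^sup>+r. ennreal (2 * r * exp (- l * r)) * indicator {0..} r \<partial>lborel) = ennreal (2 / l\<^sup>2)"
proof -
  define F where "F r = - (2 / l\<^sup>2) * (1 + l * r) * exp (- l * r)" for r
  have "(\<integral>\<^sup>+r. ennreal (2 * r * exp (- l * r)) * indicator {0..} r \<partial>lborel) = ennreal (0 - F 0)"
  proof (rule nn_integral_FTC_atLeast)
    fix r :: real assume r: "0 \<le> r"
    show "(F has_real_derivative 2 * r * exp (- l * r)) (at r)"
      unfolding F_def using l
      by (auto intro!: derivative_eq_intros simp: power2_eq_square field_simps)
    show "0 \<le> 2 * r * exp (- l * r)" using r by simp
  next
    show "(F \<longlongrightarrow> 0) at_top" unfolding F_def using l by real_asymp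
  qed simp
  also have "0 - F 0 = 2 / l\<^sup>2" by (simp add: F_def)
  finally show ?thesis .
qed

section \<open>Integral formula for the mean minimum\<close>

lemma min_sq_scale:
  assumes "1 \<le> k"
  shows "min_sq k (\<lambda>i. c * z i) = c\<^sup>2 * min_sq k z"
proof (rule antisym)
  obtain i where "i < k" "min_sq k z = (z i)\<^sup>2" using min_sq_attained[OF assms] by blast
  then show "min_sq k (\<lambda>i. c * z i) \<le> c\<^sup>2 * min_sq k z"
    using min_sq_le[of i k "\<lambda>i. c * z i"] by (simp add: power_mult_distrib)
  obtain j where "j < k" "min_sq k (\<lambda>i. c * z i) = (c * z j)\<^sup>2" using min_sq_attained[OF assms] by blast
  then show "c\<^sup>2 * min_sq k z \<le> min_sq k (\<lambda>i. c * z i)"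
    using min_sq_le[of j k z] by (simp add: power_mult_distrib mult_left_mono)
qed

lemma mean_min_sq_standardise:
  assumes "1 \<le> k" "0 < s"
  shows "mean_min_sq k D s = s\<^sup>2 * mean_min_sq k (D / s) 1"
proof -
  have "min_sq k (\<lambda>i. D + s * e i) = s\<^sup>2 * min_sq k (\<lambda>i. D / s + 1 * e i)" for e
    unfolding min_sq_scale[OF assms(1), symmetric] using assms(2) by (simp add: algebra_simps)
  then show ?thesis by (simp add: mean_min_sq_def)
qed

text \<open>The square \<open>c^2\<close> of \<open>c = k * min \<bar>z i\<bar>\<close> is the
  integral of \<open>2 r\<close> over \<open>[0, c]\<close>. Putting the factor \<open>k\<close>
  into \<open>c\<close> sets the scale on which the integrand has a limit.\<close>

lemma min_sq_layer_cake:
  assumes k: "1 \<le> k"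
  shows "ennreal ((real k)\<^sup>2 * min_sq k z) =
    (\<integral>\<^sup>+r. ennreal (if 0 \<le> r \<and> (\<forall>i<k. r \<le> real k * \<bar>z i\<bar>) then 2 * r else 0) \<partial>lborel)"
proof -
  obtain j where j: "j < k" "min_sq k z = (z j)\<^sup>2" using min_sq_attained[OF k] by blast
  define c where "c = real k * \<bar>z j\<bar>"
  have "\<bar>z j\<bar> \<le> \<bar>z i\<bar>" if "i < k" for i
    using min_sq_le[OF that, of z] unfolding j(2) by (simp add: abs_le_square_iff)
  then have "c \<le> real k * \<bar>z i\<bar>" if "i < k" for i
    using that by (simp add: c_def mult_left_mono)
  then have iff: "(\<forall>i<k. r \<le> real k * \<bar>z i\<bar>) \<longleftrightarrow> r \<le> c" for r
    using j(1) by (auto simp: c_def intro: order_trans)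
  have "(\<integral>\<^sup>+r. ennreal (if 0 \<le> r \<and> (\<forall>i<k. r \<le> real k * \<bar>z i\<bar>) then 2 * r else 0) \<partial>lborel) =
      (\<integral>\<^sup>+r. ennreal (2 * r) * indicator {0..c} r \<partial>lborel)"
    by (intro nn_integral_cong) (auto simp: iff indicator_def)
  also have "\<dots> = ennreal (c\<^sup>2 - 0\<^sup>2)"
    by (rule nn_integral_FTC_Icc[where F="\<lambda>r. r\<^sup>2"])
      (auto intro!: derivative_eq_intros simp: c_def)
  finally show ?thesis by (simp add: c_def j(2) power_mult_distrib)
qed

text \<open>The event is a product set with equal factors, so independence turns its probability
  into a \<open>k\<close>-th power.\<close>

lemma emeasure_all_far:
  assumes k: "1 \<le> k"
  shows "emeasure (std_normal_prod k) {e \<in> space (std_normal_prod k). \<forall>i<k. r \<le> real k * \<bar>a + e i\<bar>}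
    = ennreal (normal_tail a (r / real k) ^ k)"
proof -
  interpret prob_space std_normal_distribution by (rule prob_space_std_normal)
  interpret product_sigma_finite "\<lambda>_::nat. std_normal_distribution"
    by (rule product_sigma_finite.intro) (rule sigma_finite_measure_axioms)
  let ?A = "{e. r / real k \<le> \<bar>a + e\<bar>}"
  have "{e \<in> space (std_normal_prod k). \<forall>i<k. r \<le> real k * \<bar>a + e i\<bar>} = Pi\<^sub>E {..<k} (\<lambda>_. ?A)"
  proof -
    have "r \<le> real k * y \<longleftrightarrow> r / real k \<le> y" for y
      using k by (simp add: pos_divide_le_eq mult.commute)
    then show ?thesis by (auto simp: space_PiM PiE_iff extensional_def)
  qed
  then have "emeasure (std_normal_prod k) {e \<in> space (std_normal_prod k). \<forall>i<k. r \<le> real k * \<bar>a + e i\<bar>}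
      = (\<Prod>i<k. emeasure std_normal_distribution ?A)"
    by (simp only:) (rule emeasure_PiM, auto)
  also have "\<dots> = ennreal (normal_tail a (r / real k)) ^ k"
    by (simp add: normal_tail_def emeasure_eq_measure)
  finally show ?thesis by (simp add: ennreal_power normal_tail_bounds)
qed

text \<open>Tonelli's theorem applied to the layer-cake formula: integrating over the samples first
  leaves the probability that all of them are far.\<close>

lemma mean_min_sq_nn_integral:
  assumes k: "1 \<le> k"
  shows "ennreal ((real k)\<^sup>2 * mean_min_sq k a 1) =
    (\<integral>\<^sup>+r. ennreal (indicator {0..} r * (2 * r * normal_tail a (r / real k) ^ k)) \<partial>lborel)"
proof -
  interpret P: prob_space "std_normal_prod k" by (rule prob_space_std_normal_prod)
  interpret pair_sigma_finite "std_normal_prod k" lborel ..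
  let ?Q = "\<lambda>e r. 0 \<le> r \<and> (\<forall>i<k. r \<le> real k * \<bar>a + e i\<bar>)"
  let ?g = "\<lambda>e r. ennreal (if ?Q e r then 2 * r else 0)"
  have meas: "(\<lambda>(e, r). ?g e r) \<in> borel_measurable (std_normal_prod k \<Otimes>\<^sub>M lborel)"
    unfolding Ball_def[symmetric] lessThan_iff[symmetric] case_prod_beta by measurable
  have meas1: "Measurable.pred (std_normal_prod k) (\<lambda>e. \<forall>i<k. r \<le> real k * \<bar>a + e i\<bar>)" for r
    unfolding Ball_def[symmetric] lessThan_iff[symmetric] by measurable
  have "ennreal ((real k)\<^sup>2 * mean_min_sq k a 1) =
      ennreal (\<integral>e. (real k)\<^sup>2 * min_sq k (\<lambda>i. a + 1 * e i) \<partial>std_normal_prod k)"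
    by (simp add: mean_min_sq_def)
  also have "\<dots> = (\<integral>\<^sup>+e. ennreal ((real k)\<^sup>2 * min_sq k (\<lambda>i. a + 1 * e i)) \<partial>std_normal_prod k)"
    by (rule nn_integral_eq_integral[symmetric])
      (use min_sq_integrable(1)[OF k, of a 1] min_sq_nonneg[OF k] in auto)
  also have "\<dots> = (\<integral>\<^sup>+e. \<integral>\<^sup>+r. ?g e r \<partial>lborel \<partial>std_normal_prod k)"
    unfolding min_sq_layer_cake[OF k] by simp
  also have "\<dots> = (\<integral>\<^sup>+r. \<integral>\<^sup>+e. ?g e r \<partial>std_normal_prod k \<partial>lborel)"
    by (rule Fubini'[symmetric]) (rule meas)
  also have "\<dots> = (\<integral>\<^sup>+r. ennreal (indicator {0..} r * (2 * r * normal_tail a (r / real k) ^ k)) \<partial>lborel)"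
  proof (rule nn_integral_cong)
    fix r :: real
    let ?E = "{e \<in> space (std_normal_prod k). \<forall>i<k. r \<le> real k * \<bar>a + e i\<bar>}"
    have "(\<integral>\<^sup>+e. ?g e r \<partial>std_normal_prod k) =
        (\<integral>\<^sup>+e. ennreal (indicator {0..} r * (2 * r)) * indicator ?E e \<partial>std_normal_prod k)"
      by (rule nn_integral_cong) (auto simp: indicator_def)
    also have "\<dots> = ennreal (indicator {0..} r * (2 * r)) * emeasure (std_normal_prod k) ?E"
      using meas1[of r] by (intro nn_integral_cmult_indicator) (simp add: pred_def)
    also have "\<dots> = ennreal (indicator {0..} r * (2 * r * normal_tail a (r / real k) ^ k))"
      unfolding emeasure_all_far[OF k]
      by (auto simp: ennreal_mult'[symmetric] indicator_def normal_tail_bounds)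
    finally show "(\<integral>\<^sup>+e. ?g e r \<partial>std_normal_prod k) =
        ennreal (indicator {0..} r * (2 * r * normal_tail a (r / real k) ^ k))" .
  qed
  finally show ?thesis .
qed

section \<open>Domination and limit for a growing number of samples\<close>

lemma rational_tail_integrable:
  assumes "0 < h"
  shows "integrable lborel (\<lambda>r. indicator {0..} r * (2 * r * (1 / (1 + h * r) ^ 4)))"
    and "(\<integral>\<^sup>+r. ennreal (indicator {0..} r * (2 * r * (1 / (1 + h * r) ^ 4))) \<partial>lborel) = ennreal (1 / (3 * h\<^sup>2))"
proof -
  have "(\<integral>\<^sup>+r. ennreal (indicator {0..} r * (2 * r * (1 / (1 + h * r) ^ 4))) \<partial>lborel)
      = (\<integral>\<^sup>+r. ennreal (2 * r / (1 + h * r) ^ 4) * indicator {0..} r \<partial>lborel)"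
    by (rule nn_integral_cong) (auto simp: indicator_def)
  then show *: "(\<integral>\<^sup>+r. ennreal (indicator {0..} r * (2 * r * (1 / (1 + h * r) ^ 4))) \<partial>lborel) = ennreal (1 / (3 * h\<^sup>2))"
    using nn_integral_rational_tail[OF assms] by simp
  show "integrable lborel (\<lambda>r. indicator {0..} r * (2 * r * (1 / (1 + h * r) ^ 4)))"
    by (rule integrableI_nn_integral_finite[OF _ _ *])
      (auto simp: indicator_def)
qed

lemma tail_integrand_le:
  assumes "1 \<le> k"
  shows "indicator {0..} r * (2 * r * normal_tail a (r / real k) ^ k)
    \<le> indicator {0..} r * (2 * r * (1 / (1 + tail_rate a * r) ^ 4))"
proof (cases "0 \<le> r")
  case True
  then show ?thesis
    using mult_left_mono[OF normal_tail_power_le[OF True assms, of a], of "2 * r"] by simp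
qed simp

text \<open>Being uniform in \<open>k\<close>, this bound later dominates the average over
  inputs.\<close>

lemma mean_min_sq_le:
  assumes k: "1 \<le> k"
  shows "(real k)\<^sup>2 * mean_min_sq k a 1 \<le> 1 / (3 * (tail_rate a)\<^sup>2)"
proof -
  have "ennreal ((real k)\<^sup>2 * mean_min_sq k a 1) \<le> ennreal (1 / (3 * (tail_rate a)\<^sup>2))"
    unfolding mean_min_sq_nn_integral[OF k] rational_tail_integrable(2)[OF tail_rate_pos, symmetric]
    by (intro nn_integral_mono ennreal_leI tail_integrand_le k)
  then show ?thesis by (simp add: ennreal_le_iff)
qed

text \<open>Near the origin \<open>a + Z\<close> has density \<open>std_normal_density a\<close>, so
  \<open>k\<close> times the probability of the window of half-width \<open>r / k\<close> tends to
  \<open>x = 2 * r * std_normal_density a\<close>. The power is then compared with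
  \<open>(1 - x / k)^k\<close>.\<close>

lemma normal_tail_power_tendsto:
  assumes r: "0 \<le> r"
  shows "(\<lambda>k. normal_tail a (r / real k) ^ k) \<longlonglongrightarrow> exp (- (2 * std_normal_density a) * r)"
proof -
  define x where "x = 2 * r * std_normal_density a"
  define y where "y k = real k * (1 - normal_tail a (r / real k))" for k
  \<comment> \<open>Substituting \<open>t / k\<close> for \<open>t\<close> fixes the window to
    \<open>(- r, r)\<close> and moves \<open>k\<close> into the argument of the density, which tends
    to \<open>- a\<close>.\<close>
  have yeq: "y k = (\<integral>t. indicator {- r<..<r} t * std_normal_density (t / real k - a) \<partial>lborel)" if "1 \<le> k" for k
  proof -
    have kp: "0 < real k" using that by simp
    have "y k = real k * (\<integral>t. indicator {- (r / real k)<..<r / real k} t * std_normal_density (t - a) \<partial>lborel)"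
      by (simp add: y_def normal_tail_eq_integral(2))
    also have "\<dots> = real k * (\<bar>1 / real k\<bar> *\<^sub>R (\<integral>t. indicator {- (r / real k)<..<r / real k} (0 + 1 / real k * t)
        * std_normal_density (0 + 1 / real k * t - a) \<partial>lborel))"
      using kp by (subst lborel_integral_real_affine[where c="1 / real k" and t=0]) auto
    also have "\<dots> = (\<integral>t. indicator {- (r / real k)<..<r / real k} (0 + 1 / real k * t)
        * std_normal_density (0 + 1 / real k * t - a) \<partial>lborel)"
      using kp by simp
    also have "\<dots> = (\<integral>t. indicator {- r<..<r} t * std_normal_density (t / real k - a) \<partial>lborel)"
      using kp by (intro Bochner_Integration.integral_cong) (auto simp: indicator_def field_simps)
    finally show ?thesis .
  qed
  have "(\<lambda>k. \<integral>t. indicator {- r<..<r} t * std_normal_density (t / real k - a) \<partial>lborel)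
      \<longlonglongrightarrow> (\<integral>t. indicator {- r<..<r} t * std_normal_density (- a) \<partial>lborel)"
  proof (rule integral_dominated_convergence[where w="\<lambda>t. indicator {- r<..<r} t"])
    have "(\<lambda>k. std_normal_density (t / real k - a)) \<longlonglongrightarrow> std_normal_density (- a)" for t
    proof -
      have "(\<lambda>k. t / real k - a) \<longlonglongrightarrow> 0 - a"
        by (intro tendsto_diff tendsto_const lim_const_over_n)
      then have "(\<lambda>k. 1 / sqrt (2 * pi) * exp (- (t / real k - a)\<^sup>2 / 2))
          \<longlonglongrightarrow> 1 / sqrt (2 * pi) * exp (- (0 - a)\<^sup>2 / 2)"
        by (intro tendsto_mult tendsto_const tendsto_exp tendsto_divide tendsto_minus tendsto_power) auto
      then show ?thesis by (simp add: std_normal_density_def)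
    qed
    then show "AE t in lborel. (\<lambda>k. indicator {- r<..<r} t * std_normal_density (t / real k - a))
        \<longlonglongrightarrow> indicator {- r<..<r} t * std_normal_density (- a)"
      by (intro AE_I2 tendsto_mult tendsto_const)
    have le1: "std_normal_density u \<le> 1" for u
    proof -
      have "1 / sqrt (2 * pi) \<le> 1" using pi_gt3 by simp
      then have "1 / sqrt (2 * pi) * exp (- u\<^sup>2 / 2) \<le> 1 * 1"
        by (intro mult_mono) auto
      then show ?thesis by (simp add: std_normal_density_def)
    qed
    show "AE t in lborel. norm (indicator {- r<..<r} t * std_normal_density (t / real k - a))
        \<le> indicator {- r<..<r} t" for k
      by (intro AE_I2) (auto simp: indicator_def le1)
    show "integrable lborel (indicator {- r<..<r} :: real \<Rightarrow> real)"
      using r by (simp add: integrable_indicator_iff)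
  qed auto
  also have "(\<integral>t. indicator {- r<..<r} t * std_normal_density (- a) \<partial>lborel) = x"
    using r by (simp add: x_def std_normal_density_def)
  finally have y: "y \<longlonglongrightarrow> x"
    by (rule Lim_transform_eventually)
      (auto intro!: eventually_sequentiallyI[of 1] simp: yeq)
  have "(\<lambda>k. (1 + (- x) / real k) ^ k) \<longlonglongrightarrow> exp (- x)"
    by (rule tendsto_exp_limit_sequentially)
  moreover have "(\<lambda>k. normal_tail a (r / real k) ^ k - (1 + (- x) / real k) ^ k) \<longlonglongrightarrow> 0"
  proof (rule Lim_null_comparison)
    show "(\<lambda>k. \<bar>x - y k\<bar>) \<longlonglongrightarrow> 0"
      using tendsto_rabs[OF tendsto_diff[OF tendsto_const[of x] y]] by simp
    \<comment> \<open>From \<open>K\<close> on, \<open>1 - x / k\<close> lies in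
      \<open>[0, 1]\<close>. Both bases are then at most 1 in absolute value, as the estimate of a
      difference of powers by \<open>k\<close> times the difference of bases requires.\<close>
    obtain K :: nat where K: "x \<le> real K" "1 \<le> K"
      by (metis max.cobounded2 max.coboundedI1 of_nat_max order_trans real_arch_simple of_nat_le_iff max_def)
    show "\<forall>\<^sub>F k in sequentially.
        norm (normal_tail a (r / real k) ^ k - (1 + (- x) / real k) ^ k) \<le> \<bar>x - y k\<bar>"
    proof (rule eventually_sequentiallyI[of K])
      fix k assume "K \<le> k"
      then have k: "x \<le> real k" "0 < real k" using K by auto
      have x0: "0 \<le> x" using r by (simp add: x_def)
      have "norm (normal_tail a (r / real k) ^ k - (1 + (- x) / real k) ^ k)
          \<le> real k * norm (normal_tail a (r / real k) - (1 + (- x) / real k))"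
        using k x0 by (intro norm_power_diff) (auto simp: normal_tail_bounds field_simps abs_le_iff)
      also have "\<dots> = \<bar>real k * (normal_tail a (r / real k) - (1 + (- x) / real k))\<bar>"
        by (simp add: abs_mult)
      also have "real k * (normal_tail a (r / real k) - (1 + (- x) / real k)) = x - y k"
        using k by (simp add: y_def field_simps)
      finally show "norm (normal_tail a (r / real k) ^ k - (1 + (- x) / real k) ^ k) \<le> \<bar>x - y k\<bar>" .
    qed
  qed
  ultimately have "(\<lambda>k. normal_tail a (r / real k) ^ k) \<longlonglongrightarrow> exp (- x)"
    using tendsto_add by fastforce
  then show ?thesis by (simp add: x_def mult_ac)
qed

text \<open>Dominated convergence in \<open>r\<close> leaves the integral of
  \<open>2 * r * exp (- l * r)\<close>, which is \<open>2 / l^2\<close>. For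
  \<open>l = 2 * std_normal_density a\<close> this equals \<open>pi * exp (a^2)\<close>.\<close>

lemma mean_min_sq_tendsto:
  "(\<lambda>k. (real k)\<^sup>2 * mean_min_sq k a 1) \<longlonglongrightarrow> pi * exp (a\<^sup>2)"
proof (rule LIMSEQ_imp_Suc)
  define l where "l = 2 * std_normal_density a"
  \<comment> \<open>The index is shifted to \<open>Suc k\<close>, since the integral formula and its
    dominating function are available from one sample on.\<close>
  let ?f = "\<lambda>k r. indicator {0..} r * (2 * r * normal_tail a (r / real (Suc k)) ^ Suc k) :: real"
  let ?g = "\<lambda>r. indicator {0..} r * (2 * r * exp (- l * r)) :: real"
  let ?w = "\<lambda>r. indicator {0..} r * (2 * r * (1 / (1 + tail_rate a * r) ^ 4)) :: real"
  have l: "0 < l" by (simp add: l_def normal_density_pos)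
  have eq: "(real (Suc k))\<^sup>2 * mean_min_sq (Suc k) a 1 = (\<integral>r. ?f k r \<partial>lborel)" for k
  proof -
    have "(\<integral>r. ?f k r \<partial>lborel) = enn2real (\<integral>\<^sup>+r. ennreal (?f k r) \<partial>lborel)"
      by (rule integral_eq_nn_integral) (auto simp: indicator_def normal_tail_bounds)
    also have "\<dots> = enn2real (ennreal ((real (Suc k))\<^sup>2 * mean_min_sq (Suc k) a 1))"
      by (subst mean_min_sq_nn_integral) auto
    finally show ?thesis using min_sq_integrable(2)[of "Suc k" a 1] by simp
  qed
  have "(\<lambda>k. \<integral>r. ?f k r \<partial>lborel) \<longlonglongrightarrow> (\<integral>r. ?g r \<partial>lborel)"
  proof (rule integral_dominated_convergence[where w="?w"])
    show "integrable lborel ?w" by (rule rational_tail_integrable(1)[OF tail_rate_pos])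
    show "AE r in lborel. (\<lambda>k. ?f k r) \<longlonglongrightarrow> ?g r"
    proof (rule AE_I2)
      fix r :: real
      show "(\<lambda>k. ?f k r) \<longlonglongrightarrow> ?g r"
      proof (cases "0 \<le> r")
        case True
        from LIMSEQ_Suc[OF normal_tail_power_tendsto[OF True, of a]] show ?thesis
          by (intro tendsto_mult tendsto_const) (simp add: l_def)
      qed simp
    qed
    show "AE r in lborel. norm (?f k r) \<le> ?w r" for k
    proof (rule AE_I2)
      fix r :: real
      have "0 \<le> ?f k r" by (simp add: indicator_def normal_tail_bounds)
      then show "norm (?f k r) \<le> ?w r"
        using tail_integrand_le[of "Suc k" r a] by simp
    qed
  qed auto
  also have "(\<integral>r. ?g r \<partial>lborel) = pi * exp (a\<^sup>2)"
  proof -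
    have "(\<integral>\<^sup>+r. ennreal (?g r) \<partial>lborel) = (\<integral>\<^sup>+r. ennreal (2 * r * exp (- l * r)) * indicator {0..} r \<partial>lborel)"
      by (rule nn_integral_cong) (auto simp: indicator_def)
    also have "\<dots> = ennreal (2 / l\<^sup>2)" by (rule nn_integral_exp_tail[OF l])
    also have "2 / l\<^sup>2 = pi * exp (a\<^sup>2)"
    proof -
      have "(exp (- a\<^sup>2 / 2))\<^sup>2 = exp (- a\<^sup>2)" by (simp add: exp_double[symmetric])
      then show ?thesis
        by (simp add: l_def std_normal_density_def power_mult_distrib power_divide exp_minus field_simps)
    qed
    finally have "enn2real (\<integral>\<^sup>+r. ennreal (?g r) \<partial>lborel) = pi * exp (a\<^sup>2)" by simp
    moreover have "(\<integral>r. ?g r \<partial>lborel) = enn2real (\<integral>\<^sup>+r. ennreal (?g r) \<partial>lborel)"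
      by (rule integral_eq_nn_integral) (auto intro!: AE_I2 simp: indicator_def)
    ultimately show ?thesis by simp
  qed
  finally show "(\<lambda>k. (real (Suc k))\<^sup>2 * mean_min_sq (Suc k) a 1) \<longlonglongrightarrow> pi * exp (a\<^sup>2)"
    unfolding eq .
qed

text \<open>The exponential is the same \<open>exp (a^2)\<close> as in the limit; only a quadratic
  factor is lost. Any larger coefficient in the exponent would shrink the range of \<open>c\<close>
  for which the average over inputs can be dominated.\<close>

lemma inverse_tail_rate_square_le:
  "1 / (3 * (tail_rate a)\<^sup>2) \<le> 4096 * pi * exp 1 / 3 * ((1 + a\<^sup>2) * exp (a\<^sup>2))"
proof -
  have e: "(exp (- a\<^sup>2 / 2))\<^sup>2 = exp (- a\<^sup>2)" "(exp (- 1 / 2 :: real))\<^sup>2 = exp (- 1)"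
    by (simp_all add: exp_double[symmetric])
  have "(tail_rate a)\<^sup>2 = (1 / sqrt (2 * pi))\<^sup>2 * (exp (- a\<^sup>2 / 2))\<^sup>2 * (exp (- 1 / 2))\<^sup>2
      / (16\<^sup>2 * (\<bar>a\<bar> + 2)\<^sup>2)"
    unfolding tail_rate_def std_normal_density_def by (simp only: power_mult_distrib power_divide)
  also have "\<dots> = 1 / (512 * pi * exp 1 * ((\<bar>a\<bar> + 2)\<^sup>2 * exp (a\<^sup>2)))"
    unfolding e by (simp add: power_divide exp_minus field_simps)
  finally have "1 / (3 * (tail_rate a)\<^sup>2) = 512 * pi * exp 1 / 3 * ((\<bar>a\<bar> + 2)\<^sup>2 * exp (a\<^sup>2))"
    by simp
  also have "(\<bar>a\<bar> + 2)\<^sup>2 \<le> 8 * (1 + a\<^sup>2)"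
  proof -
    have "(b + 2)\<^sup>2 \<le> 8 * (1 + b\<^sup>2)" for b :: real
    proof -
      have "0 \<le> (b - 2)\<^sup>2 + 6 * b\<^sup>2" by simp
      then show ?thesis by (simp add: power2_eq_square algebra_simps)
    qed
    from this[of "\<bar>a\<bar>"] show ?thesis by simp
  qed
  finally show ?thesis by (simp add: mult_ac)
qed

section \<open>Averaging over the inputs\<close>

text \<open>The situation without matrices: \<open>D\<close> is the bias, the \<open>f l\<close> are
  the linear forms whose squares add up to the quadratic form in the predictive variance, and
  \<open>r\<close> and \<open>v l\<close> are their standard deviations. Only the individual laws
  are prescribed.\<close>

locale gaussian_predictive = prob_space M
  for M :: "'a measure" +
  fixes D :: "'a \<Rightarrow> real" and r :: real
    and f :: "nat \<Rightarrow> 'a \<Rightarrow> real" and v :: "nat \<Rightarrow> real" and n :: nat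
    and \<kappa> \<sigma> c :: real
  assumes D: "centred_normal M r D"
    and f: "\<And>l. l < n \<Longrightarrow> centred_normal M (v l) (f l)"
    and \<kappa>: "0 \<le> \<kappa>" and \<sigma>: "0 < \<sigma>"
    and c: "0 \<le> c" "c < 1" "2 * r\<^sup>2 / \<sigma>\<^sup>2 \<le> c"
begin

text \<open>The relative excess of the predictive variance over the noise variance.\<close>

definition excess :: "'a \<Rightarrow> real" where
  "excess \<omega> = \<kappa> * (\<Sum>l<n. (f l \<omega>)\<^sup>2)"

definition bias_ratio :: "'a \<Rightarrow> real" where
  "bias_ratio \<omega> = (D \<omega>)\<^sup>2 / \<sigma>\<^sup>2"

definition sd :: "'a \<Rightarrow> real" where
  "sd \<omega> = sqrt (\<sigma>\<^sup>2 * (1 + excess \<omega>))"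

text \<open>The exponent exceeds 1, yet \<open>exp (tilt * bias_ratio)\<close> is still integrable since \<open>tilt * c < 1\<close>.\<close>

definition tilt :: real where "tilt = 2 / (1 + c)"

text \<open>Up to the factor \<open>pi * \<sigma>^2\<close>, the pointwise leading coefficient:
  \<open>1 + excess\<close> is the ratio of predictive to noise variance, and the exponent is
  squared bias over predictive variance.\<close>

definition limit_density :: "'a \<Rightarrow> real" where
  "limit_density \<omega> = (1 + excess \<omega>) * exp (bias_ratio \<omega> / (1 + excess \<omega>))"

section \<open>Effect of replacing the predictive variance by the noise variance\<close>

lemma measurable_D [measurable]: "D \<in> borel_measurable M"
  using D by (simp add: centred_normal_def)

lemma measurable_f [measurable]: "l < n \<Longrightarrow> f l \<in> borel_measurable M"
  using f by (simp add: centred_normal_def)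

lemma measurable_excess [measurable]: "excess \<in> borel_measurable M"
  unfolding excess_def[abs_def] by (intro borel_measurable_times borel_measurable_const
      borel_measurable_sum borel_measurable_power measurable_f) auto

lemma measurable_bias_ratio [measurable]: "bias_ratio \<in> borel_measurable M"
  unfolding bias_ratio_def[abs_def] by measurable

lemma measurable_sd [measurable]: "sd \<in> borel_measurable M"
  unfolding sd_def[abs_def] by measurable

lemma excess_nonneg: "0 \<le> excess \<omega>"
  unfolding excess_def using \<kappa> by (intro mult_nonneg_nonneg sum_nonneg) auto

lemma bias_ratio_nonneg: "0 \<le> bias_ratio \<omega>"
  by (simp add: bias_ratio_def)

lemma sd_pos: "0 < sd \<omega>"
  unfolding sd_def using \<sigma> excess_nonneg[of \<omega>] by (simp add: add_pos_nonneg)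

lemma sd_square: "(sd \<omega>)\<^sup>2 = \<sigma>\<^sup>2 * (1 + excess \<omega>)"
  unfolding sd_def using excess_nonneg[of \<omega>] by simp

lemma tilt_gt_1: "1 < tilt"
  using c by (simp add: tilt_def field_simps)

text \<open>The linear factor is absorbed by raising the exponent from 1 to \<open>tilt\<close>; the
  constant is \<open>1 + 1 / (tilt - 1)\<close>.\<close>

lemma one_plus_mult_exp_le:
  assumes "0 \<le> g"
  shows "(1 + g) * exp g \<le> 2 / (1 - c) * exp (tilt * g)"
proof -
  have e: "0 < tilt - 1" "2 / (1 - c) = 1 + 1 / (tilt - 1)"
    using tilt_gt_1 c by (auto simp: tilt_def field_simps)
  have "(tilt - 1) * g \<le> exp ((tilt - 1) * g)"
    using exp_ge_add_one_self[of "(tilt - 1) * g"] by linarith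
  then have "g \<le> 1 / (tilt - 1) * exp ((tilt - 1) * g)"
    using e(1) by (simp add: field_simps)
  moreover have "1 \<le> 1 * exp ((tilt - 1) * g)" using e(1) assms by simp
  ultimately have "1 + g \<le> 2 / (1 - c) * exp ((tilt - 1) * g)"
    unfolding e(2) distrib_right by (intro add_mono)
  then have "(1 + g) * exp g \<le> 2 / (1 - c) * exp ((tilt - 1) * g) * exp g"
    by (intro mult_right_mono) auto
  also have "\<dots> = 2 / (1 - c) * exp (tilt * g)"
    by (simp add: exp_add[symmetric] algebra_simps)
  finally show ?thesis .
qed

lemma ratio_le: "r\<^sup>2 / \<sigma>\<^sup>2 \<le> c / 2" "tilt / \<sigma>\<^sup>2 * r\<^sup>2 \<le> c / (1 + c)" "c / (1 + c) < 1 / 2"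
proof -
  show 1: "r\<^sup>2 / \<sigma>\<^sup>2 \<le> c / 2" using c(3) by (simp add: mult.commute)
  have "tilt * (r\<^sup>2 / \<sigma>\<^sup>2) \<le> tilt * (c / 2)"
    using 1 tilt_gt_1 by (intro mult_left_mono) auto
  also have "\<dots> = c / (1 + c)" using c by (simp add: tilt_def field_simps)
  finally show "tilt / \<sigma>\<^sup>2 * r\<^sup>2 \<le> c / (1 + c)" by simp
  show "c / (1 + c) < 1 / 2" using c by (simp add: field_simps)
qed

lemma exp_bias_ratio:
  "integrable M (\<lambda>\<omega>. exp (bias_ratio \<omega>))"
  "(\<integral>\<omega>. exp (bias_ratio \<omega>) \<partial>M) = 1 / sqrt (1 - 2 * r\<^sup>2 / \<sigma>\<^sup>2)"
  "integrable M (\<lambda>\<omega>. exp (tilt * bias_ratio \<omega>))"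
proof -
  have 1: "1 / \<sigma>\<^sup>2 * r\<^sup>2 < 1 / 2" using ratio_le(1) c(2) by simp
  show "integrable M (\<lambda>\<omega>. exp (bias_ratio \<omega>))"
    "(\<integral>\<omega>. exp (bias_ratio \<omega>) \<partial>M) = 1 / sqrt (1 - 2 * r\<^sup>2 / \<sigma>\<^sup>2)"
    using centred_normal_exp_square[OF D 1] by (simp_all add: bias_ratio_def)
  have 2: "tilt / \<sigma>\<^sup>2 * r\<^sup>2 < 1 / 2" using ratio_le(2,3) by linarith
  show "integrable M (\<lambda>\<omega>. exp (tilt * bias_ratio \<omega>))"
    using centred_normal_exp_square(1)[OF D 2] by (simp add: bias_ratio_def)
qed

text \<open>The factor \<open>\<kappa>\<close> times the sum of the \<open>(v l)^2\<close> is the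
  mean of \<open>excess\<close>, so the weighted mean is small whenever the plain mean is.\<close>

lemma excess_exp_bias_ratio:
  "integrable M (\<lambda>\<omega>. excess \<omega> * exp (tilt * bias_ratio \<omega>))"
  "(\<integral>\<omega>. excess \<omega> * exp (tilt * bias_ratio \<omega>) \<partial>M) \<le> young_const (c / (1 + c)) * (\<kappa> * (\<Sum>l<n. (v l)\<^sup>2))"
proof -
  have c0: "0 \<le> c / (1 + c)" using c by simp
  have l0: "0 \<le> tilt / \<sigma>\<^sup>2" using tilt_gt_1 by simp
  note sq = square_times_exp_square[OF f D c0 ratio_le(3) l0 ratio_le(2)]
  have eq: "excess \<omega> * exp (tilt * bias_ratio \<omega>) = \<kappa> * (\<Sum>l<n. (f l \<omega>)\<^sup>2 * exp (tilt / \<sigma>\<^sup>2 * (D \<omega>)\<^sup>2))" for \<omega>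
    by (simp add: excess_def bias_ratio_def sum_distrib_right)
  show "integrable M (\<lambda>\<omega>. excess \<omega> * exp (tilt * bias_ratio \<omega>))"
    unfolding eq using sq(1) by (intro integrable_mult_right Bochner_Integration.integrable_sum) auto
  have "(\<integral>\<omega>. excess \<omega> * exp (tilt * bias_ratio \<omega>) \<partial>M) =
      \<kappa> * (\<Sum>l<n. \<integral>\<omega>. (f l \<omega>)\<^sup>2 * exp (tilt / \<sigma>\<^sup>2 * (D \<omega>)\<^sup>2) \<partial>M)"
    unfolding eq using sq(1) by (subst integral_mult_right_zero, subst Bochner_Integration.integral_sum) auto
  also have "\<dots> \<le> \<kappa> * (\<Sum>l<n. young_const (c / (1 + c)) * (v l)\<^sup>2)"
    using sq(2) \<kappa> by (intro mult_left_mono sum_mono) auto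
  also have "\<dots> = young_const (c / (1 + c)) * (\<kappa> * (\<Sum>l<n. (v l)\<^sup>2))"
    unfolding sum_distrib_left[symmetric] by (rule mult.left_commute)
  finally show "(\<integral>\<omega>. excess \<omega> * exp (tilt * bias_ratio \<omega>) \<partial>M) \<le> young_const (c / (1 + c)) * (\<kappa> * (\<Sum>l<n. (v l)\<^sup>2))" .
qed

lemma dominating_integrable:
  "integrable M (\<lambda>\<omega>. (1 + excess \<omega>) * exp (tilt * bias_ratio \<omega>))"
  unfolding distrib_right using exp_bias_ratio(3) excess_exp_bias_ratio(1) by simp

text \<open>The upper estimate uses \<open>exp (g / (1 + t)) <= exp g\<close>. The lower one uses
  \<open>exp (- z) >= 1 - z\<close> at \<open>z = g * t / (1 + t)\<close>, the loss in the exponent.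
  Both errors are linear in \<open>t\<close>.\<close>

lemma limit_density_deviation:
  "\<bar>limit_density \<omega> - exp (bias_ratio \<omega>)\<bar> \<le> 2 / (1 - c) * (excess \<omega> * exp (tilt * bias_ratio \<omega>))"
proof -
  define t where "t = excess \<omega>"
  define g where "g = bias_ratio \<omega>"
  have t: "0 \<le> t" and g: "0 \<le> g"
    by (simp_all add: t_def g_def excess_nonneg bias_ratio_nonneg)
  have "(1 + t) * exp (g / (1 + t)) \<le> (1 + t) * exp g"
    using t g by (intro mult_left_mono) (auto simp: divide_le_eq mult_le_cancel_left1 algebra_simps)
  then have up: "(1 + t) * exp (g / (1 + t)) - exp g \<le> t * exp g"
    by (simp add: algebra_simps)
  have "1 - g * t / (1 + t) \<le> exp (- (g * t / (1 + t)))"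
    using exp_ge_add_one_self[of "- (g * t / (1 + t))"] by simp
  then have "(1 + t) * exp g * (1 - g * t / (1 + t)) \<le> (1 + t) * exp g * exp (- (g * t / (1 + t)))"
    using t by (intro mult_left_mono) auto
  also have "(1 + t) * exp g * exp (- (g * t / (1 + t))) = (1 + t) * exp (g / (1 + t))"
  proof -
    have "g + - (g * t / (1 + t)) = g / (1 + t)" using t by (simp add: field_simps)
    then show ?thesis by (simp add: mult.assoc exp_add[symmetric])
  qed
  also have "(1 + t) * exp g * (1 - g * t / (1 + t)) = exp g * (1 + t - g * t)"
    using t by (simp add: field_simps)
  finally have low: "exp g - (1 + t) * exp (g / (1 + t)) \<le> t * ((g - 1) * exp g)"
    by (simp add: algebra_simps)
  have a: "t * exp g \<le> t * ((1 + g) * exp g)" and b: "t * ((g - 1) * exp g) \<le> t * ((1 + g) * exp g)"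
    using t g by (auto intro!: mult_left_mono simp: mult_right_mono)
  have "\<bar>(1 + t) * exp (g / (1 + t)) - exp g\<bar> \<le> t * ((1 + g) * exp g)"
    using order_trans[OF up a] order_trans[OF low b] by (simp add: abs_le_iff)
  also have "\<dots> \<le> t * (2 / (1 - c) * exp (tilt * g))"
    using one_plus_mult_exp_le[OF g] t by (rule mult_left_mono)
  finally show ?thesis by (simp add: limit_density_def t_def g_def mult_ac)
qed

text \<open>Averaging the pointwise deviation leaves the Gaussian integral of
  \<open>exp (bias_ratio)\<close>, the source of the inverse square root, and an error proportional
  to the mean of \<open>excess\<close>.\<close>

lemma limit_density_integral:
  "integrable M limit_density"
  "\<bar>(\<integral>\<omega>. limit_density \<omega> \<partial>M) - 1 / sqrt (1 - 2 * r\<^sup>2 / \<sigma>\<^sup>2)\<bar>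
    \<le> 2 / (1 - c) * young_const (c / (1 + c)) * (\<kappa> * (\<Sum>l<n. (v l)\<^sup>2))"
proof -
  have meas [measurable]: "limit_density \<in> borel_measurable M"
    unfolding limit_density_def[abs_def] by measurable
  have int: "integrable M (\<lambda>\<omega>. 2 / (1 - c) * (excess \<omega> * exp (tilt * bias_ratio \<omega>)))"
    using excess_exp_bias_ratio(1) by (rule integrable_mult_right)
  have diff: "integrable M (\<lambda>\<omega>. limit_density \<omega> - exp (bias_ratio \<omega>))"
  proof (rule Bochner_Integration.integrable_bound[OF int])
    show "AE \<omega> in M. norm (limit_density \<omega> - exp (bias_ratio \<omega>))
        \<le> norm (2 / (1 - c) * (excess \<omega> * exp (tilt * bias_ratio \<omega>)))"
      unfolding real_norm_def by (rule AE_I2) (rule order_trans[OF limit_density_deviation abs_ge_self])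
  qed measurable
  from Bochner_Integration.integrable_add[OF diff exp_bias_ratio(1)]
  show ld: "integrable M limit_density" by simp
  have "\<bar>(\<integral>\<omega>. limit_density \<omega> \<partial>M) - 1 / sqrt (1 - 2 * r\<^sup>2 / \<sigma>\<^sup>2)\<bar> =
      \<bar>\<integral>\<omega>. limit_density \<omega> - exp (bias_ratio \<omega>) \<partial>M\<bar>"
    using ld exp_bias_ratio by simp
  also have "\<dots> \<le> (\<integral>\<omega>. \<bar>limit_density \<omega> - exp (bias_ratio \<omega>)\<bar> \<partial>M)"
    by (rule integral_abs_bound)
  also have "\<dots> \<le> (\<integral>\<omega>. 2 / (1 - c) * (excess \<omega> * exp (tilt * bias_ratio \<omega>)) \<partial>M)"
    using diff by (intro integral_mono int limit_density_deviation integrable_abs)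
  also have "\<dots> \<le> 2 / (1 - c) * (young_const (c / (1 + c)) * (\<kappa> * (\<Sum>l<n. (v l)\<^sup>2)))"
    using excess_exp_bias_ratio(2) c
    by (subst integral_mult_right_zero) (intro mult_left_mono, auto)
  finally show "\<bar>(\<integral>\<omega>. limit_density \<omega> \<partial>M) - 1 / sqrt (1 - 2 * r\<^sup>2 / \<sigma>\<^sup>2)\<bar>
    \<le> 2 / (1 - c) * young_const (c / (1 + c)) * (\<kappa> * (\<Sum>l<n. (v l)\<^sup>2))"
    by (simp only: mult.assoc)
qed

section \<open>The two limits under the average over inputs\<close>

lemma measurable_mean_min_sq [measurable]:
  "(\<lambda>\<omega>. mean_min_sq k (D \<omega>) (sd \<omega>)) \<in> borel_measurable M"
  by (rule borel_measurable_mean_min_sq) measurable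

text \<open>The standardised bias satisfies \<open>a^2 <= bias_ratio\<close>, since the predictive
  variance is at least the noise variance. The right-hand side is free of \<open>k\<close> and
  integrable.\<close>

lemma sq_mean_min_sq_le:
  assumes k: "1 \<le> k"
  shows "(real k)\<^sup>2 * mean_min_sq k (D \<omega>) (sd \<omega>) \<le>
    \<sigma>\<^sup>2 * (4096 * pi * exp 1 / 3 * (2 / (1 - c))) * ((1 + excess \<omega>) * exp (tilt * bias_ratio \<omega>))"
proof -
  define C :: real where "C = 4096 * pi * exp 1 / 3"
  have C: "0 \<le> C" by (simp add: C_def)
  define a where "a = D \<omega> / sd \<omega>"
  have a: "a\<^sup>2 = bias_ratio \<omega> / (1 + excess \<omega>)"
    by (simp add: a_def power_divide sd_square bias_ratio_def)
  have ag: "a\<^sup>2 \<le> bias_ratio \<omega>"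
    unfolding a using excess_nonneg[of \<omega>] bias_ratio_nonneg[of \<omega>]
    by (simp add: divide_le_eq mult_le_cancel_left1 algebra_simps)
  have "(real k)\<^sup>2 * mean_min_sq k a 1 \<le> C * ((1 + a\<^sup>2) * exp (a\<^sup>2))"
    using mean_min_sq_le[OF k, of a] inverse_tail_rate_square_le[of a] unfolding C_def by linarith
  also have "\<dots> \<le> C * (2 / (1 - c) * exp (tilt * bias_ratio \<omega>))"
  proof (rule mult_left_mono[OF _ C])
    have "(1 + a\<^sup>2) * exp (a\<^sup>2) \<le> (1 + bias_ratio \<omega>) * exp (bias_ratio \<omega>)"
      using ag by (intro mult_mono) (auto simp: bias_ratio_nonneg)
    also have "\<dots> \<le> 2 / (1 - c) * exp (tilt * bias_ratio \<omega>)"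
      by (rule one_plus_mult_exp_le[OF bias_ratio_nonneg])
    finally show "(1 + a\<^sup>2) * exp (a\<^sup>2) \<le> 2 / (1 - c) * exp (tilt * bias_ratio \<omega>)" .
  qed
  finally have "(sd \<omega>)\<^sup>2 * ((real k)\<^sup>2 * mean_min_sq k a 1) \<le>
      (sd \<omega>)\<^sup>2 * (C * (2 / (1 - c) * exp (tilt * bias_ratio \<omega>)))"
    by (intro mult_left_mono) auto
  then show ?thesis
    unfolding mean_min_sq_standardise[OF k sd_pos] a_def[symmetric] C_def[symmetric] sd_square
    by (simp add: mult_ac)
qed

lemma integrable_mean_min_sq:
  assumes k: "1 \<le> k"
  shows "integrable M (\<lambda>\<omega>. mean_min_sq k (D \<omega>) (sd \<omega>))"
proof -
  have "integrable M (\<lambda>\<omega>. (real k)\<^sup>2 * mean_min_sq k (D \<omega>) (sd \<omega>))"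
  proof (rule Bochner_Integration.integrable_bound[OF integrable_mult_right[OF dominating_integrable]])
    show "AE \<omega> in M. norm ((real k)\<^sup>2 * mean_min_sq k (D \<omega>) (sd \<omega>)) \<le>
        norm (\<sigma>\<^sup>2 * (4096 * pi * exp 1 / 3 * (2 / (1 - c))) * ((1 + excess \<omega>) * exp (tilt * bias_ratio \<omega>)))"
    proof (rule AE_I2)
      fix \<omega>
      have "0 \<le> (real k)\<^sup>2 * mean_min_sq k (D \<omega>) (sd \<omega>)"
        by (intro mult_nonneg_nonneg min_sq_integrable(2) k) auto
      then show "norm ((real k)\<^sup>2 * mean_min_sq k (D \<omega>) (sd \<omega>)) \<le>
          norm (\<sigma>\<^sup>2 * (4096 * pi * exp 1 / 3 * (2 / (1 - c))) * ((1 + excess \<omega>) * exp (tilt * bias_ratio \<omega>)))"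
        using order_trans[OF sq_mean_min_sq_le[OF k] abs_ge_self, of \<omega>]
        by (simp only: real_norm_def abs_of_nonneg[of "(real k)\<^sup>2 * _"])
    qed
  qed measurable
  then show ?thesis using k by simp
qed

text \<open>Pointwise, rescaling to unit variance gives the limit
  \<open>sd^2 * pi * exp (D^2 / sd^2)\<close>; the bound uniform in \<open>k\<close> then permits
  dominated convergence over the inputs.\<close>

lemma sq_mean_min_sq_tendsto:
  "(\<lambda>k. (real k)\<^sup>2 * (\<integral>\<omega>. mean_min_sq k (D \<omega>) (sd \<omega>) \<partial>M))
    \<longlonglongrightarrow> pi * \<sigma>\<^sup>2 * (\<integral>\<omega>. limit_density \<omega> \<partial>M)"
proof (rule LIMSEQ_imp_Suc)
  have [measurable]: "limit_density \<in> borel_measurable M"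
    using limit_density_integral(1) by simp
  have "(\<lambda>k. \<integral>\<omega>. (real (Suc k))\<^sup>2 * mean_min_sq (Suc k) (D \<omega>) (sd \<omega>) \<partial>M)
      \<longlonglongrightarrow> (\<integral>\<omega>. pi * \<sigma>\<^sup>2 * limit_density \<omega> \<partial>M)"
  proof (rule integral_dominated_convergence)
    show "AE \<omega> in M. (\<lambda>k. (real (Suc k))\<^sup>2 * mean_min_sq (Suc k) (D \<omega>) (sd \<omega>)) \<longlonglongrightarrow> pi * \<sigma>\<^sup>2 * limit_density \<omega>"
    proof (rule AE_I2)
      fix \<omega>
      have eq: "(real (Suc k))\<^sup>2 * mean_min_sq (Suc k) (D \<omega>) (sd \<omega>) =
          (sd \<omega>)\<^sup>2 * ((real (Suc k))\<^sup>2 * mean_min_sq (Suc k) (D \<omega> / sd \<omega>) 1)" for k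
        by (subst mean_min_sq_standardise[OF _ sd_pos]) auto
      have "(\<lambda>k. (sd \<omega>)\<^sup>2 * ((real (Suc k))\<^sup>2 * mean_min_sq (Suc k) (D \<omega> / sd \<omega>) 1))
          \<longlonglongrightarrow> (sd \<omega>)\<^sup>2 * (pi * exp ((D \<omega> / sd \<omega>)\<^sup>2))"
        by (intro tendsto_mult tendsto_const LIMSEQ_Suc[OF mean_min_sq_tendsto])
      also have "(sd \<omega>)\<^sup>2 * (pi * exp ((D \<omega> / sd \<omega>)\<^sup>2)) = pi * \<sigma>\<^sup>2 * limit_density \<omega>"
        by (simp add: power_divide sd_square limit_density_def bias_ratio_def)
      finally show "(\<lambda>k. (real (Suc k))\<^sup>2 * mean_min_sq (Suc k) (D \<omega>) (sd \<omega>)) \<longlonglongrightarrow> pi * \<sigma>\<^sup>2 * limit_density \<omega>"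
        unfolding eq .
    qed
    show "integrable M (\<lambda>\<omega>. \<sigma>\<^sup>2 * (4096 * pi * exp 1 / 3 * (2 / (1 - c))) * ((1 + excess \<omega>) * exp (tilt * bias_ratio \<omega>)))"
      by (rule integrable_mult_right[OF dominating_integrable])
    show "AE \<omega> in M. norm ((real (Suc k))\<^sup>2 * mean_min_sq (Suc k) (D \<omega>) (sd \<omega>))
        \<le> \<sigma>\<^sup>2 * (4096 * pi * exp 1 / 3 * (2 / (1 - c))) * ((1 + excess \<omega>) * exp (tilt * bias_ratio \<omega>))" for k
    proof (rule AE_I2)
      fix \<omega>
      have "0 \<le> (real (Suc k))\<^sup>2 * mean_min_sq (Suc k) (D \<omega>) (sd \<omega>)"
        by (intro mult_nonneg_nonneg min_sq_integrable(2)) auto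
      then show "norm ((real (Suc k))\<^sup>2 * mean_min_sq (Suc k) (D \<omega>) (sd \<omega>))
        \<le> \<sigma>\<^sup>2 * (4096 * pi * exp 1 / 3 * (2 / (1 - c))) * ((1 + excess \<omega>) * exp (tilt * bias_ratio \<omega>))"
        using sq_mean_min_sq_le[of "Suc k" \<omega>] by (simp only: real_norm_def abs_of_nonneg)
    qed
  qed measurable
  then show "(\<lambda>k. (real (Suc k))\<^sup>2 * (\<integral>\<omega>. mean_min_sq (Suc k) (D \<omega>) (sd \<omega>) \<partial>M))
      \<longlonglongrightarrow> pi * \<sigma>\<^sup>2 * (\<integral>\<omega>. limit_density \<omega> \<partial>M)"
    by (simp only: integral_mult_right_zero)
qed

lemma mean_softmin_tendsto:
  assumes k: "1 \<le> k"
  shows "((\<lambda>T. \<integral>\<omega>. (\<integral>e. softmin k T (\<lambda>i. D \<omega> + sd \<omega> * e i) \<partial>std_normal_prod k) \<partial>M)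
    \<longlongrightarrow> (\<integral>\<omega>. mean_min_sq k (D \<omega>) (sd \<omega>) \<partial>M)) (at_right 0)"
proof (rule tendsto_sandwich)
  let ?q = "\<lambda>T \<omega>. \<integral>e. softmin k T (\<lambda>i. D \<omega> + sd \<omega> * e i) \<partial>std_normal_prod k"
  let ?m = "\<lambda>\<omega>. mean_min_sq k (D \<omega>) (sd \<omega>)"
  note im = integrable_mean_min_sq[OF k]
  have bounds: "(\<integral>\<omega>. ?m \<omega> \<partial>M) \<le> (\<integral>\<omega>. ?q T \<omega> \<partial>M) \<and> (\<integral>\<omega>. ?q T \<omega> \<partial>M) \<le> (\<integral>\<omega>. ?m \<omega> \<partial>M) + real k * T"
    if T: "0 < T" for T
  proof -
    have i2: "integrable M (\<lambda>\<omega>. ?m \<omega> + real k * T)" using im by simp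
    have iq: "integrable M (?q T)"
    proof (rule Bochner_Integration.integrable_bound[OF i2])
      show "?q T \<in> borel_measurable M"
        by (rule borel_measurable_mean_softmin) measurable
      show "AE \<omega> in M. norm (?q T \<omega>) \<le> norm (?m \<omega> + real k * T)"
      proof (rule AE_I2)
        fix \<omega>
        have "0 \<le> ?q T \<omega>" "?q T \<omega> \<le> ?m \<omega> + real k * T"
          using mean_softmin_bounds[OF k T, of "D \<omega>" "sd \<omega>"] min_sq_integrable(2)[OF k, of "D \<omega>" "sd \<omega>"]
          by linarith+
        then show "norm (?q T \<omega>) \<le> norm (?m \<omega> + real k * T)" by simp
      qed
    qed
    have "(\<integral>\<omega>. ?m \<omega> \<partial>M) \<le> (\<integral>\<omega>. ?q T \<omega> \<partial>M)"
      by (rule integral_mono[OF im iq]) (rule mean_softmin_bounds(1)[OF k T])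
    moreover have "(\<integral>\<omega>. ?q T \<omega> \<partial>M) \<le> (\<integral>\<omega>. ?m \<omega> + real k * T \<partial>M)"
      by (rule integral_mono[OF iq i2]) (rule mean_softmin_bounds(2)[OF k T])
    ultimately show ?thesis using im prob_space by simp
  qed
  show "\<forall>\<^sub>F T in at_right 0. (\<integral>\<omega>. ?m \<omega> \<partial>M) \<le> (\<integral>\<omega>. ?q T \<omega> \<partial>M)"
    using bounds by (auto simp: eventually_at_filter)
  show "\<forall>\<^sub>F T in at_right 0. (\<integral>\<omega>. ?q T \<omega> \<partial>M) \<le> (\<integral>\<omega>. ?m \<omega> \<partial>M) + real k * T"
    using bounds by (auto simp: eventually_at_filter)
  have "((\<lambda>T. (\<integral>\<omega>. ?m \<omega> \<partial>M) + real k * T) \<longlongrightarrow> (\<integral>\<omega>. ?m \<omega> \<partial>M) + real k * 0) (at_right 0)"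
    by (intro tendsto_intros)
  then show "((\<lambda>T. (\<integral>\<omega>. ?m \<omega> \<partial>M) + real k * T) \<longlongrightarrow> (\<integral>\<omega>. ?m \<omega> \<partial>M)) (at_right 0)" by simp
qed simp

end

section \<open>From one problem instance to the asymptotic regime\<close>

text \<open>A quantitative statement for a single instance. The prefactor of the error depends on
  \<open>c\<close> alone, so the estimate is uniform along a sequence of instances.\<close>

lemma gen_err_limits:
  assumes d: "0 < d" and S: "cov_mat d S" and w: "w \<in> carrier_vec d"
    and pos: "0 < \<sigma>" "0 < \<gamma>" "0 < R"
    and X: "gaussian_vec M d S X" and u: "u = B_mat d S R *\<^sub>v w"
    and c: "0 \<le> c" "c < 1" "2 / (\<sigma>\<^sup>2 * real d) * (u \<bullet> (S *\<^sub>v u)) \<le> c"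
  shows "\<exists>\<delta> L. (\<forall>k\<ge>1. ((\<lambda>T. gen_err M X d S R \<sigma> \<gamma> w w k T) \<longlongrightarrow> \<delta> k) (at_right 0)) \<and>
    (\<lambda>k. (real k)\<^sup>2 * \<delta> k) \<longlonglongrightarrow> pi * \<sigma>\<^sup>2 * L \<and>
    \<bar>L - 1 / sqrt (1 - 2 / (\<sigma>\<^sup>2 * real d) * (u \<bullet> (S *\<^sub>v u)))\<bar>
      \<le> 2 / (1 - c) * young_const (c / (1 + c)) * (\<gamma>\<^sup>2 / real d * mat_trace (B_mat d S R * S) / \<sigma>\<^sup>2)"
proof -
  have Sc: "S \<in> carrier_mat d d" and psd: "\<And>v. v \<in> carrier_vec d \<Longrightarrow> 0 \<le> v \<bullet> (S *\<^sub>v v)"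
    using S by (auto simp: cov_mat_def)
  have Xc: "X \<omega> \<in> carrier_vec d" if "\<omega> \<in> space M" for \<omega>
    using X that by (simp add: gaussian_vec_def)
  have uc: "u \<in> carrier_vec d" using B_mat_carrier[OF S pos(3)] w by (simp add: u)
  obtain a where a: "\<And>l. a l \<in> carrier_vec d"
    and quad: "\<And>x. x \<in> carrier_vec d \<Longrightarrow> x \<bullet> (B_mat d S R *\<^sub>v x) = (\<Sum>l<d. (a l \<bullet> x)\<^sup>2)"
    and tr: "mat_trace (B_mat d S R * S) = (\<Sum>l<d. a l \<bullet> (S *\<^sub>v a l))"
    using B_mat_sum_of_squares[OF S pos(3)] by blast
  define b where "b = (- 1 / sqrt (real d)) \<cdot>\<^sub>v u"
  have b: "b \<in> carrier_vec d" using uc by (simp add: b_def)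
  have bSb: "b \<bullet> (S *\<^sub>v b) = (u \<bullet> (S *\<^sub>v u)) / real d"
    using Sc uc d by (simp add: b_def mult_mat_vec[of _ d d])
  have ratio: "2 * (sqrt (b \<bullet> (S *\<^sub>v b)))\<^sup>2 / \<sigma>\<^sup>2 = 2 / (\<sigma>\<^sup>2 * real d) * (u \<bullet> (S *\<^sub>v u))"
    using psd[OF b] by (simp add: bSb)
  \<comment> \<open>The parameter \<open>\<kappa>\<close> is the coefficient of the quadratic form
    in \<open>pred_var\<close> divided by the noise variance.\<close>
  interpret gaussian_predictive M "\<lambda>\<omega>. b \<bullet> X \<omega>" "sqrt (b \<bullet> (S *\<^sub>v b))"
    "\<lambda>l \<omega>. a l \<bullet> X \<omega>" "\<lambda>l. sqrt (a l \<bullet> (S *\<^sub>v a l))" d "\<gamma>\<^sup>2 / (real d * \<sigma>\<^sup>2)" \<sigma> c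
  proof (intro gaussian_predictive.intro gaussian_predictive_axioms.intro)
    show "prob_space M" using X by (simp add: gaussian_vec_def)
    show "2 * (sqrt (b \<bullet> (S *\<^sub>v b)))\<^sup>2 / \<sigma>\<^sup>2 \<le> c" unfolding ratio by (rule c(3))
  qed (use gaussian_vec_linear[OF X S] a b pos c in auto)
  have at: "gen_err_at d S R \<sigma> \<gamma> w w k T (X \<omega>) =
      (\<integral>e. softmin k T (\<lambda>i. b \<bullet> X \<omega> + sd \<omega> * e i) \<partial>std_normal_prod k)"
    if \<omega>: "\<omega> \<in> space M" for k T \<omega>
  proof -
    note x = Xc[OF \<omega>]
    have bias: "pred_mean d S R w (X \<omega>) - lin_mean d w (X \<omega>) = b \<bullet> X \<omega>"
      unfolding pred_mean_minus_lin_mean[OF S pos(3) w x] using uc x by (simp add: b_def u)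
    have var: "pred_var d S R \<sigma> \<gamma> (X \<omega>) = \<sigma>\<^sup>2 * (1 + excess \<omega>)"
      using pos(1) by (simp add: pred_var_def excess_def quad[OF x] field_simps)
    have "0 < pred_var d S R \<sigma> \<gamma> (X \<omega>)"
      unfolding var using pos(1) excess_nonneg[of \<omega>] by (simp add: add_pos_nonneg)
    from gen_err_at_eq_softmin[OF this, of w k T] show ?thesis
      unfolding bias var sd_def .
  qed
  have eq: "gen_err M X d S R \<sigma> \<gamma> w w k T =
      (\<integral>\<omega>. (\<integral>e. softmin k T (\<lambda>i. b \<bullet> X \<omega> + sd \<omega> * e i) \<partial>std_normal_prod k) \<partial>M)" for k T
    unfolding gen_err_def by (rule Bochner_Integration.integral_cong[OF refl at])
  have "(\<Sum>l<d. (sqrt (a l \<bullet> (S *\<^sub>v a l)))\<^sup>2) = mat_trace (B_mat d S R * S)"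
    unfolding tr using psd a by simp
  then have t: "\<gamma>\<^sup>2 / (real d * \<sigma>\<^sup>2) * (\<Sum>l<d. (sqrt (a l \<bullet> (S *\<^sub>v a l)))\<^sup>2) =
      \<gamma>\<^sup>2 / real d * mat_trace (B_mat d S R * S) / \<sigma>\<^sup>2"
    by simp
  show ?thesis
    unfolding eq
    by (intro exI[of _ "\<lambda>k. \<integral>\<omega>. mean_min_sq k (b \<bullet> X \<omega>) (sd \<omega>) \<partial>M"]
        exI[of _ "\<integral>\<omega>. limit_density \<omega> \<partial>M"] conjI allI impI mean_softmin_tendsto
        sq_mean_min_sq_tendsto limit_density_integral(2)[unfolded t ratio])
qed

text \<open>The relation "much smaller" is read as little-o along a sequence of instances indexed by
  \<open>N\<close>. For each \<open>N\<close> the limit in \<open>T\<close> comes first, then that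
  in \<open>k\<close>, and the resulting coefficient \<open>L N\<close> is asymptotically equivalent
  to the claimed one. The uniform bound \<open>c < 1\<close> keeps the square root away from
  zero.\<close>

theorem mainTheorem6:
  fixes d n :: "nat \<Rightarrow> nat"
    and S :: "nat \<Rightarrow> real mat"
    and w u :: "nat \<Rightarrow> real vec"
    and \<alpha> \<sigma> \<gamma> R :: "nat \<Rightarrow> real"
    and M :: "nat \<Rightarrow> 'a measure"
    and X :: "nat \<Rightarrow> 'a \<Rightarrow> real vec"
    and c :: real
  assumes dims: "\<And>N. 0 < d N"
    and alpha: "\<And>N. \<alpha> N = real (d N) / real (n N)" "\<And>N. d N < n N"
    and cov: "\<And>N. cov_mat (d N) (S N)"
    and tr: "(\<lambda>N. mat_trace (S N)) \<in> \<Theta>(\<lambda>N. real (d N))"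
    and w: "\<And>N. w N \<in> carrier_vec (d N)" "\<And>N. w N \<bullet> w N = real (d N)"
    and pos: "\<And>N. 0 < \<sigma> N" "\<And>N. 0 < \<gamma> N" "\<And>N. 0 < R N"
    and R: "\<And>N. R N * (1 - \<alpha> N * m_fun (d N) (S N) (R N)) = (\<sigma> N)\<^sup>2 / (\<gamma> N)\<^sup>2 * \<alpha> N"
    and X: "\<And>N. gaussian_vec (M N) (d N) (S N) (X N)"
    and u: "\<And>N. u N = B_mat (d N) (S N) (R N) *\<^sub>v w N"
    and regime: "(\<lambda>N. (\<gamma> N)\<^sup>2 / real (d N) * mat_trace (B_mat (d N) (S N) (R N) * S N))
                   \<in> o(\<lambda>N. (\<sigma> N)\<^sup>2)"
    and finite_err: "c < 1" "\<And>N. 2 / ((\<sigma> N)\<^sup>2 * real (d N)) * (u N \<bullet> (S N *\<^sub>v u N)) \<le> c"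
  shows "\<exists>\<delta>0 L.
    (\<forall>N k. k \<ge> 1 \<longrightarrow>
       ((\<lambda>T. gen_err (M N) (X N) (d N) (S N) (R N) (\<sigma> N) (\<gamma> N) (w N) (w N) k T)
          \<longlongrightarrow> \<delta>0 N k) (at_right 0)) \<and>
    (\<forall>N. (\<lambda>k. (real k)\<^sup>2 * \<delta>0 N k) \<longlonglongrightarrow> L N) \<and>
    L \<sim>[sequentially]
      (\<lambda>N. pi * (\<sigma> N)\<^sup>2 * (1 / sqrt (1 - 2 / ((\<sigma> N)\<^sup>2 * real (d N)) * (u N \<bullet> (S N *\<^sub>v u N)))))"
proof -
  \<comment> \<open>The estimate for one instance asks for a nonnegative bound; \<open>c'\<close>
    still stays below 1.\<close>
  define c' where "c' = max c 0"
  define K where "K = 2 / (1 - c') * young_const (c' / (1 + c'))"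
  define q where "q N = 2 / ((\<sigma> N)\<^sup>2 * real (d N)) * (u N \<bullet> (S N *\<^sub>v u N))" for N
  define t where "t N = (\<gamma> N)\<^sup>2 / real (d N) * mat_trace (B_mat (d N) (S N) (R N) * S N) / (\<sigma> N)\<^sup>2" for N
  have q: "q N < 1" for N
    using finite_err(2)[of N] finite_err(1) by (simp add: q_def)
  have q0: "0 \<le> q N" for N
  proof -
    have "u N \<in> carrier_vec (d N)"
      using B_mat_carrier[OF cov pos(3)] w(1) unfolding u by (rule mult_mat_vec_carrier)
    then have "0 \<le> u N \<bullet> (S N *\<^sub>v u N)" using cov[of N] by (simp add: cov_mat_def)
    then show ?thesis by (simp add: q_def)
  qed
  \<comment> \<open>Bundling the three properties lets one choice over \<open>N\<close> supply
    matching \<open>\<delta>\<close> and \<open>L\<close>, the latter still without the factor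
    \<open>pi * \<sigma>^2\<close>.\<close>
  define is_limit where "is_limit N \<delta> L \<longleftrightarrow>
      (\<forall>k\<ge>1. ((\<lambda>T. gen_err (M N) (X N) (d N) (S N) (R N) (\<sigma> N) (\<gamma> N) (w N) (w N) k T)
        \<longlongrightarrow> \<delta> k) (at_right 0)) \<and>
      (\<lambda>k. (real k)\<^sup>2 * \<delta> k) \<longlonglongrightarrow> pi * (\<sigma> N)\<^sup>2 * L \<and>
      \<bar>L - 1 / sqrt (1 - q N)\<bar> \<le> K * t N" for N \<delta> L
  have "\<exists>\<delta> L. is_limit N \<delta> L" for N
    unfolding is_limit_def q_def t_def K_def
    by (rule gen_err_limits[OF dims cov w(1) pos X u])
      (use finite_err(1) finite_err(2)[of N] in \<open>auto simp: c'_def\<close>)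
  then obtain \<delta> L where "\<And>N. is_limit N (\<delta> N) (L N)" by metis
  then have
    \<delta>: "\<And>N k. 1 \<le> k \<Longrightarrow> ((\<lambda>T. gen_err (M N) (X N) (d N) (S N) (R N) (\<sigma> N) (\<gamma> N) (w N) (w N) k T)
        \<longlongrightarrow> \<delta> N k) (at_right 0)"
    and L: "\<And>N. (\<lambda>k. (real k)\<^sup>2 * \<delta> N k) \<longlonglongrightarrow> pi * (\<sigma> N)\<^sup>2 * L N"
    and dev: "\<And>N. \<bar>L N - 1 / sqrt (1 - q N)\<bar> \<le> K * t N"
    unfolding is_limit_def by blast+
  have "t \<longlonglongrightarrow> 0"
    using smalloD_tendsto[OF regime] by (simp add: t_def[abs_def])
  then have Kt: "(\<lambda>N. K * t N) \<longlonglongrightarrow> 0" by (rule tendsto_mult_right_zero)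
  \<comment> \<open>The ratio to the claimed value is \<open>L N * sqrt (1 - q N)\<close>. Since
    \<open>q N\<close> is nonnegative, the root is at most 1, so the absolute error bound carries
    over to the relative one.\<close>
  have "(\<lambda>N. L N * sqrt (1 - q N) - 1) \<longlonglongrightarrow> 0"
  proof (rule Lim_null_comparison[OF _ Kt], rule always_eventually, rule allI)
    fix N
    have s: "0 < sqrt (1 - q N)" "sqrt (1 - q N) \<le> 1" using q[of N] q0[of N] by auto
    have "norm (L N * sqrt (1 - q N) - 1) = \<bar>L N - 1 / sqrt (1 - q N)\<bar> * sqrt (1 - q N)"
    proof -
      have "L N * sqrt (1 - q N) - 1 = (L N - 1 / sqrt (1 - q N)) * sqrt (1 - q N)"
        using s(1) by (simp add: left_diff_distrib)
      then show ?thesis using s(1) by (simp add: abs_mult)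
    qed
    also have "\<dots> \<le> \<bar>L N - 1 / sqrt (1 - q N)\<bar> * 1" using s by (intro mult_left_mono) auto
    finally show "norm (L N * sqrt (1 - q N) - 1) \<le> K * t N" using dev[of N] by simp
  qed
  then have "(\<lambda>N. L N * sqrt (1 - q N) - 1 + 1) \<longlonglongrightarrow> 0 + 1"
    by (intro tendsto_add tendsto_const)
  moreover have "pi * (\<sigma> N)\<^sup>2 * L N / (pi * (\<sigma> N)\<^sup>2 * (1 / sqrt (1 - q N))) = L N * sqrt (1 - q N) - 1 + 1" for N
    using pos(1)[of N] by simp
  ultimately have "(\<lambda>N. pi * (\<sigma> N)\<^sup>2 * L N) \<sim>[sequentially] (\<lambda>N. pi * (\<sigma> N)\<^sup>2 * (1 / sqrt (1 - q N)))"
    by (intro asymp_equivI') simp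
  then show ?thesis
    using \<delta> L unfolding q_def by (intro exI[of _ \<delta>] exI[of _ "\<lambda>N. pi * (\<sigma> N)\<^sup>2 * L N"]) auto
qed

end
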